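(* Let $X$ be a finite set with $|X|\geqslant 2$. Then: (1) if $|X|$ is prime, the commuting graph $\mathcal{G}(\mathcal{P}(X))$ is not connected; (2) if $|X|=4$, then $\mathrm{diam}\,\mathcal{G}(\mathcal{P}(X))=4$; (3) if $|X|\geqslant 6$ is composite, then $\mathrm{diam}\,\mathcal{G}(\mathcal{P}(X))=5$.
   Context: $\mathcal{P}(X)$ is the partial transformation semigroup on $X$: all functions whose domain and image are subsets of $X$ (including the empty map $\emptyset$), with composition as multiplication (maps act on the right). Its center is $\{\emptyset,\mathrm{id}_X\}$, and it is non-commutative when $|X|\geqslant 2$. For a finite non-commutative semigroup $S$, the commuting graph $\mathcal{G}(S)$ is the simple graph with vertex set $S\setminus Z(S)$ ($Z(S)$ the center), two distinct vertices $x,y$ being adjacent iff $xy=yx$. The distance between two vertices is the length of a shortest path between them ($\infty$ if none), and the diameter $\mathrm{diam}$ is the maximum distance over all pairs of vertices. *)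

theory Defs
  imports
    "HOL-Algebra.Group"
    "HOL-Computational_Algebra.Primes"
    "HOL-Library.Extended_Nat"
    "Graph_Theory.Graph_Theory"
begin

text \<open>
  A partial transformation of \<open>X\<close> is a map \<open>'a \<Rightarrow> 'a option\<close>. Maps act on the right,
  so the product \<open>f g\<close> means "first \<open>f\<close>, then \<open>g\<close>".
\<close>

definition partial_transformations :: "'a set \<Rightarrow> ('a \<rightharpoonup> 'a) monoid" where
  "partial_transformations X =
    \<lparr>carrier = {f. dom f \<subseteq> X \<and> ran f \<subseteq> X},
     monoid.mult = (\<lambda>f g. g \<circ>\<^sub>m f),
     one = Some |` X\<rparr>"

text \<open>
  The center and the commuting graph are semigroup notions: only \<^const>\<open>carrier\<close> and
  \<^const>\<open>monoid.mult\<close> are used, never \<^const>\<open>one\<close>.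
\<close>

definition center :: "('a, 'b) monoid_scheme \<Rightarrow> 'a set" where
  "center S = {z \<in> carrier S. \<forall>s \<in> carrier S. z \<otimes>\<^bsub>S\<^esub> s = s \<otimes>\<^bsub>S\<^esub> z}"

text \<open>An undirected edge is represented by its two opposite arcs.\<close>

definition commuting_graph :: "('a, 'b) monoid_scheme \<Rightarrow> 'a pair_pre_digraph" where
  "commuting_graph S =
    \<lparr>pverts = carrier S - center S,
     parcs = {(x, y). x \<in> carrier S - center S \<and> y \<in> carrier S - center S \<and>
       x \<noteq> y \<and> x \<otimes>\<^bsub>S\<^esub> y = y \<otimes>\<^bsub>S\<^esub> x}\<rparr>"

text \<open>If there is no path from \<open>u\<close> to \<open>v\<close>, the infimum is \<open>\<infinity>\<close>.\<close>

definition graph_dist :: "('a, 'b) pre_digraph \<Rightarrow> 'a \<Rightarrow> 'a \<Rightarrow> enat" where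
  "graph_dist G u v = (INF p \<in> {p. pre_digraph.apath G u p v}. enat (length p))"

definition diam :: "('a, 'b) pre_digraph \<Rightarrow> enat" where
  "diam G = (SUP u \<in> verts G. SUP v \<in> verts G. graph_dist G u v)"

lemma monoid_partial_transformations: "monoid (partial_transformations X)"
proof (rule monoidI)
  fix f g
  assume fg: "f \<in> carrier (partial_transformations X)" "g \<in> carrier (partial_transformations X)"
  have "dom (g \<circ>\<^sub>m f) \<subseteq> dom f" "ran (g \<circ>\<^sub>m f) \<subseteq> ran g"
    by (auto simp: map_comp_def dom_def ran_def split: option.splits)
  then show "f \<otimes>\<^bsub>partial_transformations X\<^esub> g \<in> carrier (partial_transformations X)"
    using fg by (auto simp: partial_transformations_def)
next
  show "\<one>\<^bsub>partial_transformations X\<^esub> \<in> carrier (partial_transformations X)"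
    by (auto simp: partial_transformations_def ran_def restrict_map_def split: if_splits)
next
  fix f g h
  show "f \<otimes>\<^bsub>partial_transformations X\<^esub> g \<otimes>\<^bsub>partial_transformations X\<^esub> h =
      f \<otimes>\<^bsub>partial_transformations X\<^esub> (g \<otimes>\<^bsub>partial_transformations X\<^esub> h)"
    by (simp add: partial_transformations_def map_comp_def fun_eq_iff split: option.split)
next
  fix f assume "f \<in> carrier (partial_transformations X)"
  then have d: "dom f \<subseteq> X" and r: "ran f \<subseteq> X"
    by (auto simp: partial_transformations_def)
  have "f \<circ>\<^sub>m (Some |` X) = f"
  proof
    fix x show "(f \<circ>\<^sub>m (Some |` X)) x = f x"
      using d by (cases "x \<in> X"; cases "f x") (auto simp: map_comp_def)
  qed
  then show "\<one>\<^bsub>partial_transformations X\<^esub> \<otimes>\<^bsub>partial_transformations X\<^esub> f = f"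
    by (simp add: partial_transformations_def)
  have "(Some |` X) \<circ>\<^sub>m f = f"
  proof
    fix x show "((Some |` X) \<circ>\<^sub>m f) x = f x"
      using ranI[of f x] r by (cases "f x") (auto simp: map_comp_def)
  qed
  then show "f \<otimes>\<^bsub>partial_transformations X\<^esub> \<one>\<^bsub>partial_transformations X\<^esub> = f"
    by (simp add: partial_transformations_def)
qed

lemma finite_partial_transformations:
  assumes "finite X"
  shows "finite (carrier (partial_transformations X))"
proof -
  have "finite (\<Union>A\<in>Pow X. {m. dom m = A \<and> ran m \<subseteq> X})"
    using assms by (intro finite_UN_I finite_set_of_finite_maps) (auto intro: finite_subset)
  moreover have "carrier (partial_transformations X) \<subseteq> (\<Union>A\<in>Pow X. {m. dom m = A \<and> ran m \<subseteq> X})"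
    by (auto simp: partial_transformations_def)
  ultimately show ?thesis by (rule rev_finite_subset)
qed

lemma pair_graph_commuting_graph:
  assumes "finite (carrier S)"
  shows "pair_graph (commuting_graph S)"
proof -
  have "parcs (commuting_graph S) \<subseteq> carrier S \<times> carrier S"
    by (auto simp: commuting_graph_def)
  then have "finite (parcs (commuting_graph S))"
    using assms by (meson finite_SigmaI finite_subset)
  then show ?thesis
    using assms
    by unfold_locales
      (auto simp: commuting_graph_def symmetric_def arcs_ends_conv sym_def with_proj_def)
qed

lemma center_partial_transformations:
  "center (partial_transformations X) = {Map.empty, Some |` X}"
proof (intro equalityI subsetI)
  fix z assume "z \<in> {Map.empty, Some |` X}"
  moreover have "Some |` X \<in> center (partial_transformations X)"
    using monoid.r_one[OF monoid_partial_transformations[of X]]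
      monoid.l_one[OF monoid_partial_transformations[of X]]
      monoid.one_closed[OF monoid_partial_transformations[of X]]
    by (auto simp: center_def partial_transformations_def)
  moreover have "Map.empty \<in> center (partial_transformations X)"
    by (auto simp: center_def partial_transformations_def map_comp_def fun_eq_iff split: option.split)
  ultimately show "z \<in> center (partial_transformations X)" by blast
next
  fix z assume z: "z \<in> center (partial_transformations X)"
  then have dz: "dom z \<subseteq> X" "ran z \<subseteq> X"
    by (auto simp: center_def partial_transformations_def)
  have comm: "s \<circ>\<^sub>m z = z \<circ>\<^sub>m s" if "dom s \<subseteq> X" "ran s \<subseteq> X" for s
    using z that by (auto simp: center_def partial_transformations_def)
  \<comment> \<open>commuting with the one-point maps \<open>a \<mapsto> b\<close>\<close>
  have one_pt: "([a \<mapsto> b] \<circ>\<^sub>m z) a = (z \<circ>\<^sub>m [a \<mapsto> b]) a" if "a \<in> X" "b \<in> X" for a b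
    using comm[of "[a \<mapsto> b]"] that by (auto simp: fun_eq_iff)
  show "z \<in> {Map.empty, Some |` X}"
  proof (cases "z = Map.empty")
    case False
    then obtain a y where a: "z a = Some y" by (auto simp: fun_eq_iff)
    then have aX: "a \<in> X" using dz by auto
    have "(if y = a then Some a else None) = Some y"
      using one_pt[OF aX aX] by (simp add: a map_comp_def)
    then have "y = a" by (metis option.distinct(1))
    then have za: "z a = Some a" using a by (simp only:)
    have zb: "z b = Some b" if b: "b \<in> X" for b
    proof -
      have "Some b = z b" using one_pt[OF aX b] by (simp add: za map_comp_def)
      then show ?thesis by (rule sym)
    qed
    have "z = Some |` X"
    proof
      fix x show "z x = (Some |` X) x"
        using dz(1) zb[of x] by (cases "x \<in> X"; cases "z x") auto
    qed
    then show ?thesis by simp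
  qed simp
qed

end

theory Submission
  imports Defs "HOL-Number_Theory.Cong"
begin

text \<open>
  Let \<open>n = |X|\<close>. An \<open>n\<close>-cycle commutes only with the empty map and its own powers; for prime
  \<open>n\<close> its nontrivial powers are again \<open>n\<close>-cycles, so they form a whole component.

  Upper bounds: every noncentral map commutes with one of the following: a map with a single point
  in its domain, a nonconstant total idempotent, a constant total map, the identity of a proper
  subset, or (if it is an \<open>n\<close>-cycle and \<open>n\<close> is composite) a permutation with a proper invariant
  subset. All of these except the constants commute with the identity of some proper subset, and any
  two such identities commute; a constant is within distance two of every identity of a proper subset
  and of every constant. This gives distance at most five. For \<open>n = 4\<close> any two of the listed maps
  have a common noncentral commuting partner, which gives distance at most four.

  Lower bounds: call a map a lollipop if its functional graph is a single path leading into a cycle.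
  It commutes only with the empty map and its own powers, and all its nontrivial powers have a common
  idempotent power \<open>E\<close> (the collapse onto the cycle). So two lollipops are at distance at least five
  if their collapses have no common noncentral commuting partner. For \<open>n \<ge> 8\<close> such a pair is given
  explicitly; for \<open>n = 6\<close> a lollipop with a cycle of length three is paired with a 6-cycle. For
  \<open>n = 4\<close> a lollipop with a fixed point is compared with a 4-cycle, no nontrivial power of which
  has a fixed point.
\<close>

section \<open>Distances and the commuting relation\<close>

definition noncentral :: "'a set \<Rightarrow> ('a \<rightharpoonup> 'a) set" where
  "noncentral X = {f. dom f \<subseteq> X \<and> ran f \<subseteq> X} - {Map.empty, Some |` X}"

text \<open>Contains the diagonal, unlike the adjacency of the graph, so that for vertices
  \<open>f\<close> and \<open>g\<close> membership in \<open>crel X ^^ k\<close> means distance at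
  most \<open>k\<close>.\<close>

definition crel :: "'a set \<Rightarrow> (('a \<rightharpoonup> 'a) \<times> ('a \<rightharpoonup> 'a)) set" where
  "crel X = {(f, g). f \<in> noncentral X \<and> g \<in> noncentral X \<and> g \<circ>\<^sub>m f = f \<circ>\<^sub>m g}"

abbreviation cgraph :: "'a set \<Rightarrow> ('a \<rightharpoonup> 'a, ('a \<rightharpoonup> 'a) \<times> ('a \<rightharpoonup> 'a)) pre_digraph" where
  "cgraph X \<equiv> with_proj (commuting_graph (partial_transformations X))"

lemma noncentral_eq:
  "carrier (partial_transformations X) - center (partial_transformations X) = noncentral X"
  unfolding center_partial_transformations by (simp add: partial_transformations_def noncentral_def)

lemma verts_cgraph: "verts (cgraph X) = noncentral X"
  by (simp add: commuting_graph_def noncentral_eq)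

lemma arcs_cgraph: "arcs (cgraph X) = crel X - Id"
proof -
  have "f \<otimes>\<^bsub>partial_transformations X\<^esub> g = g \<circ>\<^sub>m f" for f g :: "'a \<rightharpoonup> 'a"
    by (simp add: partial_transformations_def)
  moreover have "x \<in> carrier (partial_transformations X) - center (partial_transformations X)
      \<longleftrightarrow> x \<in> noncentral X" for x
    by (simp only: noncentral_eq)
  ultimately have "arcs (cgraph X) =
      {(f, g). f \<in> noncentral X \<and> g \<in> noncentral X \<and> f \<noteq> g \<and> g \<circ>\<^sub>m f = f \<circ>\<^sub>m g}"
    by (simp only: commuting_graph_def with_proj_simps pair_pre_digraph.simps)
  then show ?thesis by (simp only: crel_def) fast
qed

lemma wf_digraph_cgraph: "wf_digraph (cgraph X)"
proof
  fix e assume "e \<in> arcs (cgraph X)"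
  then have "e \<in> crel X" unfolding arcs_cgraph by simp
  then show "tail (cgraph X) e \<in> verts (cgraph X)" "head (cgraph X) e \<in> verts (cgraph X)"
    unfolding verts_cgraph by (auto simp: crel_def)
qed

lemma crel_refl: "f \<in> noncentral X \<Longrightarrow> (f, f) \<in> crel X"
  by (simp add: crel_def)

lemma crel_sym: "(f, g) \<in> crel X \<Longrightarrow> (g, f) \<in> crel X"
  by (auto simp: crel_def)

lemma crel_pow_sym: "(f, g) \<in> crel X ^^ k \<Longrightarrow> (g, f) \<in> crel X ^^ k"
proof (induction k arbitrary: g)
  case (Suc k)
  then obtain h where "(f, h) \<in> crel X ^^ k" "(h, g) \<in> crel X" by auto
  then show ?case using Suc.IH crel_sym by (blast intro: relpow_Suc_I2)
qed auto

lemma crel_pow_mono: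
  assumes "(f, g) \<in> crel X ^^ k" "f \<in> noncentral X" "k \<le> l"
  shows "(f, g) \<in> crel X ^^ l"
proof -
  have "(f, g) \<in> crel X ^^ (d + k)" for d
    using assms(1) crel_refl[OF assms(2)] by (induction d) (auto intro: relpow_Suc_I2 simp del: relpow.simps)
  from this[of "l - k"] show ?thesis using assms(3) by simp
qed

text \<open>\<open>graph_dist\<close> ranges over paths without repeated vertices, whereas relation
  powers give walks. Cutting out the closed walk between two visits of a vertex gives a shorter
  walk, hence the induction on length.\<close>

lemma (in wf_digraph) awalk_imp_shorter_apath:
  assumes "awalk u p v"
  shows "\<exists>q. apath u q v \<and> length q \<le> length p"
  using assms
proof (induction "length p" arbitrary: p rule: less_induct)
  case less
  show ?case
  proof (cases "distinct (awalk_verts u p)")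
    case True
    then show ?thesis using less.prems by (auto simp: apath_def)
  next
    case False
    obtain q r s w where "p = q @ r @ s" "0 < length r" "awalk u q w" "awalk w s v"
      using awalk_not_distinct_decomp[OF less.prems False] by blast
    then show ?thesis using less.hyps[of "q @ s"] by fastforce
  qed
qed

text \<open>Diagonal steps of \<open>crel\<close> are not arcs and are dropped, so the walk may be
  shorter than \<open>k\<close>.\<close>

lemma crel_pow_imp_awalk:
  assumes "(f, g) \<in> crel X ^^ k" "f \<in> noncentral X"
  shows "\<exists>p. pre_digraph.awalk (cgraph X) f p g \<and> length p \<le> k"
  using assms
proof (induction k arbitrary: g)
  case 0
  then show ?case
    using verts_cgraph[of X] by (auto intro!: exI[of _ "[]"] simp: wf_digraph.awalk_Nil_iff[OF wf_digraph_cgraph])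
next
  case (Suc k)
  then obtain h where h: "(f, h) \<in> crel X ^^ k" "(h, g) \<in> crel X" by auto
  then obtain p where p: "pre_digraph.awalk (cgraph X) f p h" "length p \<le> k"
    using Suc by blast
  show ?case
  proof (cases "h = g")
    case True
    then show ?thesis using p by (auto intro: le_SucI)
  next
    case False
    then have "(h, g) \<in> arcs (cgraph X)" using h arcs_cgraph by auto
    then have "pre_digraph.awalk (cgraph X) h [(h, g)] g"
      by (auto simp: wf_digraph.awalk_simps[OF wf_digraph_cgraph] verts_cgraph[simplified]
          arcs_cgraph[simplified] crel_def)
    with p(1) have "pre_digraph.awalk (cgraph X) f (p @ [(h, g)]) g"
      by (rule wf_digraph.awalk_appendI[OF wf_digraph_cgraph])
    then show ?thesis using p(2) by (intro exI[of _ "p @ [(h, g)]"]) auto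
  qed
qed

lemma awalk_imp_crel_pow:
  assumes "pre_digraph.awalk (cgraph X) f p g"
  shows "(f, g) \<in> crel X ^^ length p"
  using assms
proof (induction p arbitrary: f)
  case Nil
  then show ?case by (simp add: wf_digraph.awalk_Nil_iff[OF wf_digraph_cgraph])
next
  case (Cons e p)
  then have "e \<in> arcs (cgraph X)" "f = fst e" "pre_digraph.awalk (cgraph X) (snd e) p g"
    by (auto simp: wf_digraph.awalk_Cons_iff[OF wf_digraph_cgraph])
  then show ?case using Cons.IH[of "snd e"] arcs_cgraph[of X]
    by (metis DiffD1 length_Cons prod.collapse relpow_Suc_I2)
qed

lemma graph_dist_cgraph_le:
  assumes "(f, g) \<in> crel X ^^ k" "f \<in> noncentral X"
  shows "graph_dist (cgraph X) f g \<le> enat k"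
proof -
  obtain p where "pre_digraph.apath (cgraph X) f p g" "length p \<le> k"
    using crel_pow_imp_awalk[OF assms] wf_digraph.awalk_imp_shorter_apath[OF wf_digraph_cgraph]
    by (meson le_trans)
  then show ?thesis unfolding graph_dist_def by (intro INF_lower2[of p]) auto
qed

lemma graph_dist_cgraph_ge:
  assumes "(f, g) \<notin> crel X ^^ k" "f \<in> noncentral X"
  shows "enat (Suc k) \<le> graph_dist (cgraph X) f g"
  unfolding graph_dist_def
proof (rule INF_greatest)
  fix p assume "p \<in> {p. pre_digraph.apath (cgraph X) f p g}"
  then have "(f, g) \<in> crel X ^^ length p"
    using awalk_imp_crel_pow by (auto simp: pre_digraph.apath_def)
  then have "\<not> length p \<le> k" using crel_pow_mono assms by blast
  then show "enat (Suc k) \<le> enat (length p)" by simp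
qed

lemma diam_cgraph_eqI:
  assumes "\<And>f g. f \<in> noncentral X \<Longrightarrow> g \<in> noncentral X \<Longrightarrow> (f, g) \<in> crel X ^^ Suc k"
    and "f \<in> noncentral X" "g \<in> noncentral X" "(f, g) \<notin> crel X ^^ k"
  shows "diam (cgraph X) = enat (Suc k)"
proof (rule antisym)
  show "diam (cgraph X) \<le> enat (Suc k)"
    unfolding diam_def verts_cgraph using assms(1) by (intro SUP_least graph_dist_cgraph_le)
  have "enat (Suc k) \<le> graph_dist (cgraph X) f g" by (rule graph_dist_cgraph_ge[OF assms(4,2)])
  also have "\<dots> \<le> diam (cgraph X)"
    unfolding diam_def verts_cgraph using assms(2,3) by (meson SUP_upper2 SUP_upper)
  finally show "enat (Suc k) \<le> diam (cgraph X)" .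
qed

text \<open>Connectedness is strong connectedness of the symmetrised graph; as \<open>crel\<close>
  is symmetric, symmetrising adds nothing outside it.\<close>

lemma connected_cgraph_imp_rtrancl:
  assumes "Digraph_Component.connected (cgraph X)" "f \<in> noncentral X" "g \<in> noncentral X"
  shows "(f, g) \<in> (crel X)\<^sup>*"
proof -
  let ?H = "with_proj (mk_symmetric (cgraph X))"
  have "f \<rightarrow>\<^sup>*\<^bsub>?H\<^esub> g"
    using assms verts_cgraph[of X]
    unfolding Digraph_Component.connected_def strongly_connected_def
    by (simp add: mk_symmetric_def)
  then have "(f, g) \<in> (arcs_ends ?H)\<^sup>*"
    by (metis reachable_def rtrancl_on_rtranclI)
  moreover have "arcs_ends ?H = arcs (cgraph X) \<union> (arcs (cgraph X))\<inverse>"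
    by (auto simp: mk_symmetric_def)
  moreover have "arcs (cgraph X) \<subseteq> crel X" unfolding arcs_cgraph by (rule Diff_subset)
  moreover have "(crel X)\<inverse> = crel X" by (auto intro: crel_sym)
  ultimately have "(f, g) \<in> (arcs (cgraph X) \<union> (arcs (cgraph X))\<inverse>)\<^sup>*"
      and sub: "arcs (cgraph X) \<union> (arcs (cgraph X))\<inverse> \<subseteq> crel X"
    using converse_mono[of "arcs (cgraph X)" "crel X"] by (simp_all only: Un_subset_iff simp_thms)
  then show ?thesis by (intro subsetD[OF rtrancl_mono[OF sub]])
qed

section \<open>Partial maps with explicit domain\<close>

text \<open>Separates the domain from the values, which turns commuting into a first-order condition
  on \<open>D\<close> and \<open>F\<close>. Values of \<open>F\<close> outside \<open>D\<close> do
  not matter.\<close>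

definition pmap :: "'a set \<Rightarrow> ('a \<Rightarrow> 'a) \<Rightarrow> 'a \<rightharpoonup> 'a" where
  "pmap D F = (\<lambda>x. if x \<in> D then Some (F x) else None)"

lemma pmap_eq_iff: "pmap D F = pmap E G \<longleftrightarrow> D = E \<and> (\<forall>x\<in>D. F x = G x)"
proof
  assume eq: "pmap D F = pmap E G"
  have "(x \<in> D \<longleftrightarrow> x \<in> E) \<and> (x \<in> D \<longrightarrow> F x = G x)" for x
    using fun_cong[OF eq, of x] by (simp add: pmap_def split: if_splits)
  then show "D = E \<and> (\<forall>x\<in>D. F x = G x)" by blast
qed (auto simp: pmap_def)

lemma pmap_noncentral_iff:
  "pmap D F \<in> noncentral X \<longleftrightarrow>
    D \<noteq> {} \<and> D \<subseteq> X \<and> F ` D \<subseteq> X \<and> \<not> (D = X \<and> (\<forall>x\<in>X. F x = x))"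
proof -
  have "pmap D F = Map.empty \<longleftrightarrow> D = {}" by (auto simp: pmap_def fun_eq_iff)
  moreover have "Some |` X = pmap X (\<lambda>x. x)" by (auto simp: pmap_def restrict_map_def)
  moreover have "dom (pmap D F) = D" "ran (pmap D F) = F ` D"
    by (auto simp: pmap_def dom_def ran_def)
  ultimately show ?thesis by (auto simp: noncentral_def pmap_eq_iff)
qed

lemma noncentral_cases:
  assumes "f \<in> noncentral X"
  obtains D F where "f = pmap D F" "D \<noteq> {}" "D \<subseteq> X" "F ` D \<subseteq> X"
    "\<not> (D = X \<and> (\<forall>x\<in>X. F x = x))"
proof -
  have "f = pmap (dom f) (the \<circ> f)" by (auto simp: pmap_def fun_eq_iff)
  then show thesis
    using assms that[of "dom f" "the \<circ> f"] pmap_noncentral_iff[of "dom f" "the \<circ> f" X] by simp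
qed

lemma pmap_commute_iff:
  "pmap E G \<circ>\<^sub>m pmap D F = pmap D F \<circ>\<^sub>m pmap E G \<longleftrightarrow>
    (\<forall>x. (x \<in> D \<and> F x \<in> E \<longleftrightarrow> x \<in> E \<and> G x \<in> D) \<and>
         (x \<in> D \<and> F x \<in> E \<longrightarrow> G (F x) = F (G x)))"
proof -
  have "(pmap E G \<circ>\<^sub>m pmap D F) x = (pmap D F \<circ>\<^sub>m pmap E G) x \<longleftrightarrow>
    (x \<in> D \<and> F x \<in> E \<longleftrightarrow> x \<in> E \<and> G x \<in> D) \<and>
    (x \<in> D \<and> F x \<in> E \<longrightarrow> G (F x) = F (G x))" for x
    by (simp add: pmap_def map_comp_def)
  then show ?thesis by (simp add: fun_eq_iff)
qed

lemma crelI: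
  assumes "pmap D F \<in> noncentral X" "pmap E G \<in> noncentral X"
    and "\<And>x. x \<in> D \<Longrightarrow> F x \<in> E \<Longrightarrow> x \<in> E \<and> G x \<in> D \<and> G (F x) = F (G x)"
    and "\<And>x. x \<in> E \<Longrightarrow> G x \<in> D \<Longrightarrow> x \<in> D \<and> F x \<in> E"
  shows "(pmap D F, pmap E G) \<in> crel X"
proof -
  have "pmap E G \<circ>\<^sub>m pmap D F = pmap D F \<circ>\<^sub>m pmap E G"
    unfolding pmap_commute_iff using assms(3,4) by meson
  then show ?thesis using assms(1,2) by (simp add: crel_def)
qed

text \<open>With \<open>F\<close> total, the two products have as domains the preimage of
  \<open>D\<close> under \<open>F\<close> and \<open>D\<close> itself. So \<open>D\<close> must be a
  union of components of the functional graph of \<open>F\<close>, on which \<open>G\<close>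
  commutes with \<open>F\<close>.\<close>

lemma crel_total_iff:
  assumes "pmap X F \<in> noncentral X"
  shows "(pmap X F, pmap D G) \<in> crel X \<longleftrightarrow> pmap D G \<in> noncentral X \<and>
    (\<forall>x\<in>X. F x \<in> D \<longleftrightarrow> x \<in> D) \<and> (\<forall>x\<in>D. G (F x) = F (G x))"
proof (cases "pmap D G \<in> noncentral X")
  case True
  then have "D \<subseteq> X" "\<And>x. x \<in> D \<Longrightarrow> G x \<in> X" "\<And>x. x \<in> X \<Longrightarrow> F x \<in> X"
    using assms by (auto simp: pmap_noncentral_iff)
  then have "pmap D G \<circ>\<^sub>m pmap X F = pmap X F \<circ>\<^sub>m pmap D G \<longleftrightarrow>
      (\<forall>x\<in>X. F x \<in> D \<longleftrightarrow> x \<in> D) \<and> (\<forall>x\<in>D. G (F x) = F (G x))"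
    unfolding pmap_commute_iff by (meson subsetD)
  then show ?thesis using True assms by (simp add: crel_def)
qed (simp add: crel_def)

lemma funpow_closed: "F ` X \<subseteq> X \<Longrightarrow> x \<in> X \<Longrightarrow> (F ^^ k) x \<in> X"
  by (induction k) auto

text \<open>Lets a vertex of a walk be replaced by any noncentral power of it without losing a
  neighbour.\<close>

lemma crel_total_funpow:
  assumes "(pmap X F, g) \<in> crel X" "pmap X (F ^^ k) \<in> noncentral X"
  shows "(pmap X (F ^^ k), g) \<in> crel X"
proof -
  have V: "pmap X F \<in> noncentral X" "g \<in> noncentral X" using assms by (auto simp: crel_def)
  obtain D G where g: "g = pmap D G" and D: "D \<subseteq> X" "G ` D \<subseteq> X"
    using V(2) by (rule noncentral_cases)
  have F: "F ` X \<subseteq> X" using V(1) by (simp add: pmap_noncentral_iff)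
  have c: "\<forall>x\<in>X. F x \<in> D \<longleftrightarrow> x \<in> D" "\<forall>x\<in>D. G (F x) = F (G x)"
    using assms(1) crel_total_iff[OF V(1)] g by auto
  have dom: "(F ^^ k) x \<in> D \<longleftrightarrow> x \<in> D" if "x \<in> X" for x k
    using that c(1) funpow_closed[OF F] by (induction k) auto
  have "G ((F ^^ k) x) = (F ^^ k) (G x)" if "x \<in> D" for x k
    using that c(2) dom D by (induction k) auto
  then show ?thesis using crel_total_iff[OF assms(2)] g V(2) dom by auto
qed

section \<open>Canonical commuting partners\<close>

lemma relpow_trans: "(x, y) \<in> R ^^ m \<Longrightarrow> (y, z) \<in> R ^^ n \<Longrightarrow> (x, z) \<in> R ^^ (m + n)"
  by (auto simp: relpow_add)

lemma relpow_2I: "(x, y) \<in> R \<Longrightarrow> (y, z) \<in> R \<Longrightarrow> (x, z) \<in> R ^^ 2"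
  by (auto simp: numeral_2_eq_2)

definition idem2 :: "'a set \<Rightarrow> ('a \<Rightarrow> 'a) \<Rightarrow> bool" where
  "idem2 X E \<longleftrightarrow> E ` X \<subseteq> X \<and> (\<forall>x\<in>X. E (E x) = E x) \<and> (\<exists>x\<in>X. E x \<noteq> x) \<and> (\<exists>x\<in>X. \<exists>y\<in>X. E x \<noteq> E y)"

text \<open>On a finite nonempty \<open>X\<close> this says that \<open>F\<close> is one cycle
  through all points. Minimality is the form in which the case split of
  \<open>noncentral_obtain\<close> delivers it.\<close>

definition cyc_perm :: "'a set \<Rightarrow> ('a \<Rightarrow> 'a) \<Rightarrow> bool" where
  "cyc_perm X F \<longleftrightarrow> F ` X \<subseteq> X \<and> inj_on F X \<and> (\<forall>A\<subseteq>X. A \<noteq> {} \<and> F ` A \<subseteq> A \<longrightarrow> A = X)"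

text \<open>By pigeonhole the powers of \<open>F\<close> on \<open>X\<close> are periodic from some
  index \<open>i \<ge> 1\<close> on, with period \<open>p\<close>. The exponent \<open>i * p\<close>
  is at least \<open>i\<close> and a multiple of \<open>p\<close>, so doubling it changes
  nothing.\<close>

lemma ex_idempotent_funpow:
  assumes "finite X" "F ` X \<subseteq> X"
  shows "\<exists>k>0. \<forall>x\<in>X. (F ^^ k) ((F ^^ k) x) = (F ^^ k) x"
proof -
  have "finite ((\<lambda>k. restrict (F ^^ k) X) ` {1..})"
    by (rule finite_subset[OF _ finite_PiE[OF assms(1), of "\<lambda>_. X"]])
      (use assms funpow_closed[OF assms(2)] in auto)
  then have "\<not> inj_on (\<lambda>k. restrict (F ^^ k) X) {1..}"
    using finite_imageD infinite_Ici by blast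
  then obtain i j where "1 \<le> i" "1 \<le> j" "i \<noteq> j" and "restrict (F ^^ i) X = restrict (F ^^ j) X"
    by (auto simp: inj_on_def)
  then obtain i p where i: "1 \<le> i" "0 < p" and eq: "restrict (F ^^ i) X = restrict (F ^^ (i + p)) X"
    by (metis less_imp_add_positive linorder_neqE_nat)
  have step: "(F ^^ (i + p)) x = (F ^^ i) x" if "x \<in> X" for x
    using fun_cong[OF eq, of x] that by simp
  have per: "(F ^^ (j + p)) x = (F ^^ j) x" if "x \<in> X" "i \<le> j" for x j
  proof -
    have "j + p = (j - i) + (i + p)" "j = (j - i) + i" using that(2) by simp_all
    then have "(F ^^ (j + p)) x = (F ^^ (j - i)) ((F ^^ (i + p)) x)"
      "(F ^^ j) x = (F ^^ (j - i)) ((F ^^ i) x)"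
      by (metis funpow_add comp_apply)+
    then show ?thesis using step[OF that(1)] by simp
  qed
  have per': "(F ^^ (i * p + q * p)) x = (F ^^ (i * p)) x" if "x \<in> X" for x q
  proof (induction q)
    case (Suc q)
    have "i \<le> i * p + q * p" using i(2) by (simp add: trans_le_add1)
    from per[OF that this] Suc show ?case by (simp add: ac_simps)
  qed simp
  have "(F ^^ (i * p)) ((F ^^ (i * p)) x) = (F ^^ (i * p)) x" if "x \<in> X" for x
    using per'[OF that, of i] by (simp add: funpow_add)
  then show ?thesis using i by (intro exI[of _ "i * p"]) auto
qed

text \<open>A finite set mapped injectively into itself is mapped onto itself, so by injectivity no
  outside point can enter it.\<close>

lemma inj_invariant:
  assumes "finite X" "inj_on F X" "A \<subseteq> X" "F ` A \<subseteq> A" "x \<in> X" "F x \<in> A"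
  shows "x \<in> A"
proof -
  have "F ` A = A"
    using assms by (meson endo_inj_surj finite_subset inj_on_subset)
  then obtain y where "y \<in> A" "F y = F x" using assms(6) by (metis imageE)
  then show ?thesis using assms(2,3,5) by (metis inj_onD subsetD)
qed

text \<open>A properly partial map misses a point \<open>r\<close> of its domain and a point
  \<open>x\<close> of its image, and then both products with the map from \<open>x\<close> to
  \<open>r\<close> are empty. A total non-injective map has an idempotent power. A permutation
  either has a proper invariant subset or is a full cycle.\<close>

lemma noncentral_obtain:
  assumes X: "finite X" "card X \<ge> 2" and f: "f \<in> noncentral X"
  obtains
    (point) x r where "x \<in> X" "r \<in> X" "(f, pmap {x} (\<lambda>_. r)) \<in> crel X"
  | (idem) E where "idem2 X E" "(f, pmap X E) \<in> crel X"
  | (const) a where "a \<in> X" "(f, pmap X (\<lambda>_. a)) \<in> crel X"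
  | (sub) A where "A \<noteq> {}" "A \<subset> X" "(f, pmap A (\<lambda>x. x)) \<in> crel X"
  | (cyc) F where "f = pmap X F" "cyc_perm X F"
proof -
  obtain D F where fD: "f = pmap D F" and D: "D \<noteq> {}" "D \<subseteq> X" "F ` D \<subseteq> X"
    "\<not> (D = X \<and> (\<forall>x\<in>X. F x = x))"
    using f by (rule noncentral_cases)
  show thesis
  proof (cases "D = X")
    case False
    then obtain r where r: "r \<in> X" "r \<notin> D" using D(2) by blast
    have "card (F ` D) < card X"
      using False D(2) X(1) by (meson card_image_le finite_subset le_less_trans psubsetI psubset_card_mono)
    then have "F ` D \<noteq> X" by blast
    then obtain x where x: "x \<in> X" "x \<notin> F ` D" using D(3) by blast
    have "{x} \<noteq> X" using X(2) by auto
    then have "pmap {x} (\<lambda>_. r) \<in> noncentral X" using x(1) r(1) by (simp add: pmap_noncentral_iff)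
    then have "(f, pmap {x} (\<lambda>_. r)) \<in> crel X"
      using f r x unfolding fD by (intro crelI) auto
    then show thesis using point x r by blast
  next
    case True
    note fX = fD[unfolded True]
    have F: "F ` X \<subseteq> X" "\<exists>x\<in>X. F x \<noteq> x" using D True by auto
    show thesis
    proof (cases "inj_on F X")
      case False
      obtain k where k: "k > 0" "\<And>x. x \<in> X \<Longrightarrow> (F ^^ k) ((F ^^ k) x) = (F ^^ k) x"
        using ex_idempotent_funpow[OF X(1) F(1)] by blast
      let ?E = "F ^^ k"
      obtain u v where uv: "u \<in> X" "v \<in> X" "u \<noteq> v" "F u = F v" using False by (auto simp: inj_on_def)
      \<comment> \<open>Every positive power of \<open>F\<close> identifies \<open>u\<close> and
        \<open>v\<close>, so the idempotent is not the identity.\<close>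
      then have "?E u = ?E v" using k(1) by (cases k) (simp_all add: funpow_Suc_right del: funpow.simps)
      then have ne: "\<exists>x\<in>X. ?E x \<noteq> x" using uv by metis
      have E: "?E ` X \<subseteq> X" using funpow_closed[OF F(1)] by auto
      have nc: "pmap X ?E \<in> noncentral X"
        using D(1) True E ne by (auto simp: pmap_noncentral_iff)
      have rel: "(f, pmap X ?E) \<in> crel X"
        using crel_sym[OF crel_total_funpow[OF crel_refl[OF f[unfolded fX]] nc]] unfolding fX .
      show thesis
      proof (cases "\<exists>x\<in>X. \<exists>y\<in>X. ?E x \<noteq> ?E y")
        case True
        then have "idem2 X ?E" using k E ne by (simp add: idem2_def)
        then show thesis using idem rel by blast
      next
        case False
        then have "\<forall>x\<in>X. ?E x = ?E u" using uv(1) by blast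
        then have "pmap X ?E = pmap X (\<lambda>_. ?E u)" by (simp only: pmap_eq_iff simp_thms)
        then show thesis using const[of "?E u"] rel E uv(1) by auto
      qed
    next
      case inj: True
      show thesis
      proof (cases "cyc_perm X F")
        case True
        then show thesis using cyc fX by blast
      next
        case False
        then obtain A where A: "A \<subseteq> X" "A \<noteq> {}" "F ` A \<subseteq> A" "A \<noteq> X"
          using F inj by (auto simp: cyc_perm_def)
        have "F x \<in> A \<longleftrightarrow> x \<in> A" if "x \<in> X" for x
          using inj_invariant[OF X(1) inj A(1,3) that] A(3) by auto
        moreover have "pmap A (\<lambda>x. x) \<in> noncentral X" using A by (auto simp: pmap_noncentral_iff)
        ultimately have "(f, pmap A (\<lambda>x. x)) \<in> crel X"
          using f A unfolding fX by (subst crel_total_iff) auto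
        then show thesis using sub A by blast
      qed
    qed
  qed
qed

section \<open>Connections of length at most two between the canonical partners\<close>

lemma ex_outside:
  assumes "finite S" "card S < card X"
  obtains z where "z \<in> X" "z \<notin> S"
proof -
  have "\<not> X \<subseteq> S" using assms card_mono by (metis not_le)
  then show thesis using that by blast
qed

lemma pmap_point_noncentral: "card X \<ge> 2 \<Longrightarrow> x \<in> X \<Longrightarrow> r \<in> X \<Longrightarrow> pmap {x} (\<lambda>_. r) \<in> noncentral X"
  by (auto simp: pmap_noncentral_iff)

lemma pmap_const_noncentral:
  assumes "card X \<ge> 2" "a \<in> X"
  shows "pmap X (\<lambda>_. a) \<in> noncentral X"
proof -
  obtain z where "z \<in> X" "z \<noteq> a" using ex_outside[of "{a}" X] assms(1) by auto
  then have "\<not> (\<forall>x\<in>X. a = x)" by metis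
  then show ?thesis using assms(2) unfolding pmap_noncentral_iff by (intro conjI) auto
qed

lemma pmap_id_noncentral: "A \<noteq> {} \<Longrightarrow> A \<subset> X \<Longrightarrow> pmap A (\<lambda>x. x) \<in> noncentral X"
  by (auto simp: pmap_noncentral_iff)

lemma pmap_idem2_noncentral:
  assumes "idem2 X E"
  shows "pmap X E \<in> noncentral X"
proof -
  have "\<not> (\<forall>x\<in>X. E x = x)" "E ` X \<subseteq> X" "X \<noteq> {}" using assms unfolding idem2_def by fast+
  then show ?thesis unfolding pmap_noncentral_iff by blast
qed

lemma card_2_less: "card {x, y} < Suc (Suc (Suc n))"
  using card_length[of "[x, y]"] by simp

lemma card_3_less: "card {x, y, z} < Suc (Suc (Suc (Suc n)))"
  using card_length[of "[x, y, z]"] by simp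

lemma sub_sub:
  assumes "A \<noteq> {}" "A \<subset> X" "B \<noteq> {}" "B \<subset> X"
  shows "(pmap A (\<lambda>x. x), pmap B (\<lambda>x. x)) \<in> crel X"
  using assms by (intro crelI pmap_id_noncentral) auto

text \<open>The set \<open>{x, r}\<close> contains domain and image, so its identity fixes the map
  from both sides; a third point makes it proper.\<close>

lemma point_sub_ex:
  assumes "finite X" "card X \<ge> 3" "x \<in> X" "r \<in> X"
  obtains A where "A \<noteq> {}" "A \<subset> X" "(pmap {x} (\<lambda>_. r), pmap A (\<lambda>x. x)) \<in> crel X"
proof -
  have "card {x, r} < card X" using card_2_less[of x r "0"] assms(2) by linarith
  then have "{x, r} \<subset> X" using assms by auto
  then show thesis
    using assms by (intro that[of "{x, r}"] crelI pmap_id_noncentral pmap_point_noncentral) auto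
qed

text \<open>A fibre of an idempotent is entered only from itself and never left; it is proper
  because \<open>E\<close> is not constant.\<close>

lemma idem_sub_ex:
  assumes "idem2 X E"
  obtains A where "A \<noteq> {}" "A \<subset> X" "(pmap X E, pmap A (\<lambda>x. x)) \<in> crel X"
proof -
  obtain u v where uv: "u \<in> X" "v \<in> X" "E u \<noteq> E v" using assms by (auto simp: idem2_def)
  show thesis
  proof (rule that[of "{x \<in> X. E x = E u}"])
    show *: "{x \<in> X. E x = E u} \<noteq> {}" "{x \<in> X. E x = E u} \<subset> X" using uv by (blast, metis (mono_tags, lifting) mem_Collect_eq psubsetI subsetI)
    show "(pmap X E, pmap {x \<in> X. E x = E u} (\<lambda>x. x)) \<in> crel X"
      using assms by (intro crelI pmap_idem2_noncentral pmap_id_noncentral *) (auto simp: idem2_def)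
  qed
qed

text \<open>The partner \<open>G\<close> respects the split of \<open>X\<close> into
  \<open>A\<close> and its complement: the side of \<open>a\<close> is sent to \<open>a\<close>, the
  other side to a point \<open>q\<close> in it. A third point shows that \<open>G\<close> is not the
  identity.\<close>

lemma const_sub:
  assumes "card X \<ge> 3" "a \<in> X" "A \<noteq> {}" "A \<subset> X"
  shows "(pmap X (\<lambda>_. a), pmap A (\<lambda>x. x)) \<in> crel X ^^ 2"
proof -
  obtain q where q: "q \<in> X" "q \<in> A \<longleftrightarrow> a \<notin> A" using assms by blast
  define G where "G = (\<lambda>x. if x \<in> A \<longleftrightarrow> a \<in> A then a else q)"
  obtain z where "z \<in> X" "z \<notin> {a, q}"
    using ex_outside[of "{a, q}" X] card_2_less[of a q 0] assms(1) by auto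
  then have nc: "pmap X G \<in> noncentral X"
    using assms(2) q(1) by (auto simp: pmap_noncentral_iff G_def)
  have "(pmap X (\<lambda>_. a), pmap X G) \<in> crel X"
    using assms(1,2) q(1) by (intro crelI nc pmap_const_noncentral) (auto simp: G_def)
  moreover have "(pmap X G, pmap A (\<lambda>x. x)) \<in> crel X"
    using assms(3,4) q nc by (intro crelI nc pmap_id_noncentral) (auto simp: G_def split: if_splits)
  ultimately show ?thesis by (rule relpow_2I)
qed

text \<open>A total map commutes with a constant exactly when it fixes the value, so a noncentral
  map fixing both \<open>a\<close> and \<open>b\<close> is enough.\<close>

lemma const_const:
  assumes "card X \<ge> 3" "a \<in> X" "b \<in> X"
  shows "(pmap X (\<lambda>_. a), pmap X (\<lambda>_. b)) \<in> crel X ^^ 2"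
proof -
  define G where "G = (\<lambda>x. if x = b then b else a)"
  obtain z where "z \<in> X" "z \<notin> {a, b}"
    using ex_outside[of "{a, b}" X] card_2_less[of a b 0] assms(1) by auto
  then have nc: "pmap X G \<in> noncentral X"
    using assms by (auto simp: pmap_noncentral_iff G_def)
  have "(pmap X (\<lambda>_. a), pmap X G) \<in> crel X" "(pmap X G, pmap X (\<lambda>_. b)) \<in> crel X"
    using assms by (intro crelI nc pmap_const_noncentral; auto simp: G_def)+
  then show ?thesis by (rule relpow_2I)
qed

text \<open>The middle map from \<open>z\<close> to \<open>y\<close> starts outside both images and
  ends outside both domains, so all products are empty.\<close>

lemma point_point:
  assumes "card X \<ge> 3" "x \<in> X" "r \<in> X" "x' \<in> X" "r' \<in> X"
  shows "(pmap {x} (\<lambda>_. r), pmap {x'} (\<lambda>_. r')) \<in> crel X ^^ 2"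
proof -
  obtain z where z: "z \<in> X" "z \<notin> {r, r'}"
    using ex_outside[of "{r, r'}" X] card_2_less[of r r' 0] assms(1) by auto
  obtain y where y: "y \<in> X" "y \<notin> {x, x'}"
    using ex_outside[of "{x, x'}" X] card_2_less[of x x' 0] assms(1) by auto
  have "(pmap {x} (\<lambda>_. r), pmap {z} (\<lambda>_. y)) \<in> crel X" "(pmap {z} (\<lambda>_. y), pmap {x'} (\<lambda>_. r')) \<in> crel X"
    using assms y z by (intro crelI pmap_point_noncentral; auto)+
  then show ?thesis by (rule relpow_2I)
qed

text \<open>The middle map is constant with value \<open>p\<close>, a fixed point of
  \<open>E\<close> other than \<open>x\<close>, on all points outside the fibre of \<open>r\<close>.
  The products with the one-point map are empty since \<open>r\<close> is not in \<open>?D\<close>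
  and \<open>p \<noteq> x\<close>; \<open>E\<close> respects \<open>?D\<close> and fixes
  \<open>p\<close>.\<close>

lemma point_idem:
  assumes "card X \<ge> 2" "x \<in> X" "r \<in> X" "idem2 X E"
  shows "(pmap {x} (\<lambda>_. r), pmap X E) \<in> crel X ^^ 2"
proof -
  let ?D = "{y \<in> X. E y \<noteq> E r}"
  obtain u v where uv: "u \<in> X" "v \<in> X" "E u \<noteq> E v" using assms by (auto simp: idem2_def)
  obtain w where w: "w \<in> X" "E w \<noteq> x" using uv by (cases "E u = x") auto
  define p where "p = E w"
  have p: "p \<in> X" "E p = p" "p \<noteq> x" using w assms(4) unfolding p_def idem2_def by auto
  have "u \<in> ?D \<or> v \<in> ?D" using uv by auto
  then have "?D \<noteq> {}" by blast
  then have nc: "pmap ?D (\<lambda>_. p) \<in> noncentral X"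
    using p assms(3) by (auto simp: pmap_noncentral_iff)
  have "(pmap {x} (\<lambda>_. r), pmap ?D (\<lambda>_. p)) \<in> crel X"
    using assms p by (intro crelI nc pmap_point_noncentral) auto
  moreover have "(pmap ?D (\<lambda>_. p), pmap X E) \<in> crel X"
    using assms(4) p by (intro crelI nc pmap_idem2_noncentral) (auto simp: idem2_def)
  ultimately show ?thesis by (rule relpow_2I)
qed

text \<open>The middle map moves a single point \<open>w\<close> and fixes \<open>x\<close>,
  \<open>r\<close> and \<open>a\<close>; sending \<open>w\<close> to a point other than
  \<open>x\<close> leaves \<open>x\<close> with no second preimage. Four points are needed to choose
  \<open>w\<close>.\<close>

lemma point_const:
  assumes "finite X" "card X \<ge> 4" "x \<in> X" "r \<in> X" "a \<in> X"
  shows "(pmap {x} (\<lambda>_. r), pmap X (\<lambda>_. a)) \<in> crel X ^^ 2"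
proof -
  obtain w where w: "w \<in> X" "w \<notin> {x, r, a}"
    using ex_outside[of "{x, r, a}" X] card_3_less[of x r a 0] assms(2) by auto
  obtain y where y: "y \<in> X" "y \<notin> {x, w}"
    using ex_outside[of "{x, w}" X] card_2_less[of x w 0] assms(2) by auto
  define G where "G = (\<lambda>z. if z = w then y else z)"
  have nc: "pmap X G \<in> noncentral X"
    using w y by (auto simp: pmap_noncentral_iff G_def)
  have "(pmap {x} (\<lambda>_. r), pmap X G) \<in> crel X"
    using assms w y by (intro crelI nc pmap_point_noncentral) (auto simp: G_def)
  moreover have "(pmap X G, pmap X (\<lambda>_. a)) \<in> crel X"
    using assms w y by (intro crelI nc pmap_const_noncentral) (auto simp: G_def)
  ultimately show ?thesis by (rule relpow_2I)
qed

text \<open>The middle map fixes \<open>a\<close> and sends every other point to \<open>E a\<close>.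
  The delicate case is a point with \<open>E x = a\<close>, where idempotence forces
  \<open>E a = a\<close>.\<close>

lemma idem_const:
  assumes "card X \<ge> 3" "idem2 X E" "a \<in> X"
  shows "(pmap X E, pmap X (\<lambda>_. a)) \<in> crel X ^^ 2"
proof -
  define G where "G = (\<lambda>z. if z = a then a else E a)"
  have E: "E a \<in> X" "\<And>x. x \<in> X \<Longrightarrow> E x \<in> X" "\<And>x. x \<in> X \<Longrightarrow> E (E x) = E x"
    using assms(2,3) by (auto simp: idem2_def)
  obtain z where z: "z \<in> X" "z \<notin> {a, E a}"
    using ex_outside[of "{a, E a}" X] card_2_less[of a "E a" 0] assms(1) by auto
  have nc: "pmap X G \<in> noncentral X"
    using assms(3) E z by (auto simp: pmap_noncentral_iff G_def)
  have "G (E x) = E (G x)" if "x \<in> X" for x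
  proof (cases "x = a")
    case False
    moreover have "E a = a" if "E x = a" using E(3)[OF \<open>x \<in> X\<close>] that by simp
    ultimately show ?thesis using E(3)[OF assms(3)] by (auto simp: G_def)
  qed (simp add: G_def)
  then have "(pmap X E, pmap X G) \<in> crel X"
    using E assms(3) by (intro crelI nc pmap_idem2_noncentral assms) (auto simp: G_def)
  moreover have "(pmap X G, pmap X (\<lambda>_. a)) \<in> crel X"
    using assms E by (intro crelI nc pmap_const_noncentral) (auto simp: G_def)
  ultimately show ?thesis by (rule relpow_2I)
qed

section \<open>Cyclic permutations\<close>

lemma cyc_permD:
  assumes "cyc_perm X F"
  shows "F ` X \<subseteq> X" "inj_on F X" "A \<subseteq> X \<Longrightarrow> A \<noteq> {} \<Longrightarrow> F ` A \<subseteq> A \<Longrightarrow> A = X"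
  using assms by (simp_all add: cyc_perm_def)

text \<open>The orbit of \<open>x\<close> is invariant, hence all of \<open>X\<close>. Finiteness
  and injectivity give a first return time, the orbit is injective up to that time, and counting
  identifies it with \<open>card X\<close>.\<close>

lemma cyc_perm_orbit:
  assumes X: "finite X" and F: "cyc_perm X F" and x: "x \<in> X"
  shows "X = (\<lambda>i. (F ^^ i) x) ` {0..<card X}" "inj_on (\<lambda>i. (F ^^ i) x) {0..<card X}"
    "(F ^^ card X) x = x"
proof -
  have c: "F ` X \<subseteq> X" "inj_on F X" by (rule cyc_permD[OF F])+
  have inX: "(F ^^ i) x \<in> X" for i by (rule funpow_closed[OF c(1) x])
  let ?A = "range (\<lambda>i. (F ^^ i) x)"
  have "F ((F ^^ i) x) = (F ^^ Suc i) x" for i by simp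
  then have "F ` ?A \<subseteq> ?A" by blast
  moreover have "?A \<subseteq> X" using inX by blast
  ultimately have A: "?A = X" using cyc_permD(3)[OF F] by blast
  have "finite ?A" unfolding A by (rule X)
  then have "\<not> inj (\<lambda>i. (F ^^ i) x)" by (rule contrapos_pn) (rule range_inj_infinite)
  then obtain i j where ij: "i < j" "(F ^^ i) x = (F ^^ j) x"
    unfolding inj_def by (metis linorder_neqE_nat)
  have "x = (F ^^ (j - i)) x"
  proof -
    have inj: "inj_on (F ^^ k) X" for k
    proof (induction k)
      case (Suc k)
      then show ?case using c funpow_closed[OF c(1)] by (auto simp: inj_on_def)
    qed auto
    have "(F ^^ j) x = (F ^^ i) ((F ^^ (j - i)) x)"
      using ij(1) funpow_add[of i "j - i" F] by simp
    then show ?thesis using inj_onD[OF inj[of i]] x inX ij(2) by metis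
  qed
  then have ex: "\<exists>m>0. (F ^^ m) x = x" using ij(1) by (metis zero_less_diff)
  define m where "m = (LEAST m. 0 < m \<and> (F ^^ m) x = x)"
  have m: "0 < m" "(F ^^ m) x = x" using LeastI_ex[OF ex] by (auto simp: m_def)
  have inj: "inj_on (\<lambda>i. (F ^^ i) x) {0..<m}"
  proof (rule inj_on_funpow_least[OF m(2)])
    show "(F ^^ k) x \<noteq> x" if "0 < k" "k < m" for k
      using not_less_Least[of k "\<lambda>m. 0 < m \<and> (F ^^ m) x = x"] that unfolding m_def by blast
  qed
  have "(F ^^ i) x \<in> (\<lambda>i. (F ^^ i) x) ` {0..<m}" for i
    using funpow_mod_eq[OF m(2), of i] m(1) by (intro image_eqI[of _ _ "i mod m"]) auto
  then have "X = (\<lambda>i. (F ^^ i) x) ` {0..<m}" using A by auto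
  moreover from this have "card X = m" using card_image[OF inj] by simp
  ultimately show "X = (\<lambda>i. (F ^^ i) x) ` {0..<card X}" "inj_on (\<lambda>i. (F ^^ i) x) {0..<card X}"
    "(F ^^ card X) x = x" using m inj by simp_all
qed

lemma cyc_perm_noncentral:
  assumes "finite X" "card X \<ge> 2" "cyc_perm X F" "0 < d" "d < card X"
  shows "pmap X (F ^^ d) \<in> noncentral X"
proof -
  obtain x where x: "x \<in> X" using assms(2) by fastforce
  have "(F ^^ d) ` X \<subseteq> X" using funpow_closed[OF cyc_permD(1)[OF assms(3)]] by blast
  moreover have "(F ^^ d) x \<noteq> (F ^^ 0) x"
    using inj_onD[OF cyc_perm_orbit(2)[OF assms(1,3) x], of d 0] assms(4,5) by auto
  then have "\<not> (\<forall>x\<in>X. (F ^^ d) x = x)" using x by (metis funpow_0)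
  moreover have "X \<noteq> {}" using x by blast
  ultimately show ?thesis unfolding pmap_noncentral_iff by (simp only: simp_thms order_refl)
qed

lemma cyc_perm_power:
  assumes "finite X" "card X \<ge> 2" "cyc_perm X F" "0 < d" "d < card X"
  shows "(pmap X F, pmap X (F ^^ d)) \<in> crel X"
proof -
  have "pmap X F \<in> noncentral X"
    using cyc_perm_noncentral[OF assms(1-3), of 1] assms(2) by simp
  then show ?thesis
    using crel_sym crel_total_funpow[OF crel_refl cyc_perm_noncentral[OF assms]] by blast
qed

text \<open>\<open>A\<close> is the orbit of \<open>x\<close> under \<open>F ^^ d\<close>: it closes
  up after \<open>k\<close> steps because \<open>d * k = card X\<close>, and it has at most
  \<open>k < card X\<close> points.\<close>

lemma cyc_sub_ex:
  assumes "finite X" "card X \<ge> 2" "cyc_perm X F" "card X = d * k" "1 < d" "1 < k" "x \<in> X"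
  defines "A \<equiv> (\<lambda>i. (F ^^ (d * i)) x) ` {0..<k}"
  shows "A \<noteq> {}" "A \<subset> X" "\<And>y. y \<in> A \<Longrightarrow> (F ^^ d) y \<in> A"
    "(pmap X (F ^^ d), pmap A (\<lambda>x. x)) \<in> crel X"
proof -
  have c: "F ` X \<subseteq> X" "inj_on F X" by (rule cyc_permD[OF assms(3)])+
  show ne: "A \<noteq> {}" using assms(6) by (auto simp: A_def)
  have "card A \<le> k" using card_image_le[of "{0..<k}" "\<lambda>i. (F ^^ (d * i)) x"] by (simp add: A_def)
  also have "k < card X" using assms(4-6) by simp
  finally have "A \<noteq> X" by blast
  moreover have "A \<subseteq> X" using funpow_closed[OF c(1) assms(7)] by (auto simp: A_def)
  ultimately show sub: "A \<subset> X" by blast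
  show closed: "(F ^^ d) y \<in> A" if yA: "y \<in> A" for y
  proof -
    obtain i where i: "i < k" "y = (F ^^ (d * i)) x" using yA by (auto simp: A_def)
    have y: "(F ^^ d) y = (F ^^ (d * Suc i)) x" unfolding i(2) mult_Suc_right funpow_add by simp
    show ?thesis
    proof (cases "Suc i = k")
      case True
      then have "(F ^^ d) y = (F ^^ (d * 0)) x"
        using cyc_perm_orbit(3)[OF assms(1,3,7)] y assms(4) by simp
      then show ?thesis unfolding A_def using assms(6) by (intro image_eqI[of _ _ 0]) auto
    next
      case False
      then show ?thesis using i(1) y unfolding A_def by (intro image_eqI[of _ _ "Suc i"]) auto
    qed
  qed
  have nc: "pmap X (F ^^ d) \<in> noncentral X"
    using assms(4-6) by (intro cyc_perm_noncentral assms(1-3)) auto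
  have inj: "inj_on (F ^^ k) X" for k
  proof (induction k)
    case (Suc k)
    then show ?case using c funpow_closed[OF c(1)] by (auto simp: inj_on_def)
  qed auto
  have "(F ^^ d) y \<in> A \<longleftrightarrow> y \<in> A" if "y \<in> X" for y
    using inj_invariant[OF assms(1) inj[of d] _ _ that, of A] closed sub by blast
  then show "(pmap X (F ^^ d), pmap A (\<lambda>x. x)) \<in> crel X"
    using ne sub by (subst crel_total_iff[OF nc]) (auto intro!: pmap_id_noncentral)
qed

section \<open>Upper bound five for a composite number of points\<close>

lemma composite_factor:
  assumes "\<not> prime n" "n \<ge> (2::nat)"
  obtains d k where "n = d * k" "1 < d" "1 < k"
proof -
  obtain d where d: "d dvd n" "d \<noteq> 1" "d \<noteq> n" using assms by (auto simp: prime_nat_iff)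
  then obtain k where k: "n = d * k" by blast
  then have "d \<noteq> 0" "k \<noteq> 0" "k \<noteq> 1" using d assms(2) by (auto intro!: Nat.gr0I)
  then show thesis using that[OF k] d(2) by linarith
qed

text \<open>Constants form a separate alternative because they commute with no identity of a proper
  nonempty subset. A full cycle reaches such an identity through its power by a proper divisor
  \<open>d\<close> of \<open>card X\<close>.\<close>

lemma noncentral_near_sub:
  assumes X: "finite X" "card X \<ge> 3" "\<not> prime (card X)" and f: "f \<in> noncentral X"
  shows "(\<exists>a\<in>X. (f, pmap X (\<lambda>_. a)) \<in> crel X) \<or>
    (\<exists>A. A \<noteq> {} \<and> A \<subset> X \<and> (f, pmap A (\<lambda>x. x)) \<in> crel X ^^ 2)"
proof -
  have X2: "card X \<ge> 2" using X(2) by simp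
  show ?thesis
    using X(1) X2 f
  proof (cases rule: noncentral_obtain)
    case (point x r)
    then show ?thesis using point_sub_ex[OF X(1,2), of x r] relpow_2I by metis
  next
    case (idem E)
    then show ?thesis using idem_sub_ex[of X E] relpow_2I by metis
  next
    case (const a)
    then show ?thesis by blast
  next
    case (sub A)
    then show ?thesis using crel_refl[OF f] relpow_2I by metis
  next
    case (cyc F)
    obtain d k where dk: "card X = d * k" "1 < d" "1 < k"
      using composite_factor[OF X(3) X2] by blast
    obtain x where x: "x \<in> X" using X2 by fastforce
    have "d < card X" using dk by simp
    then have "(f, pmap X (F ^^ d)) \<in> crel X"
      using cyc_perm_power[OF X(1) X2 cyc(2), of d] dk unfolding cyc(1) by simp
    then show ?thesis using cyc_sub_ex[OF X(1) X2 cyc(2) dk x] relpow_2I by metis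
  qed
qed

text \<open>The lengths add up to 2 + 1 + 2 through two subset identities, 1 + 2 + 2 through a
  constant and a subset identity, and 1 + 2 + 1 through two constants.\<close>

lemma composite_crel5:
  assumes X: "finite X" "card X \<ge> 3" "\<not> prime (card X)"
    and f: "f \<in> noncentral X" and g: "g \<in> noncentral X"
  shows "(f, g) \<in> crel X ^^ 5"
proof -
  have const_case: "(u, v) \<in> crel X ^^ 5"
    if "a \<in> X" "(u, pmap X (\<lambda>_. a)) \<in> crel X" "A \<noteq> {}" "A \<subset> X" "(v, pmap A (\<lambda>x. x)) \<in> crel X ^^ 2"
    for u v a A
  proof -
    have "(u, pmap A (\<lambda>x. x)) \<in> crel X ^^ (1 + 2)"
      by (rule relpow_trans[OF _ const_sub[OF X(2) that(1,3,4)]]) (use that(2) in simp)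
    from relpow_trans[OF this crel_pow_sym[OF that(5)]] show ?thesis by (simp add: numeral_eq_Suc)
  qed
  from noncentral_near_sub[OF X f] noncentral_near_sub[OF X g] show ?thesis
  proof (elim disjE bexE exE conjE)
    fix a b assume a: "a \<in> X" "(f, pmap X (\<lambda>_. a)) \<in> crel X" and b: "b \<in> X" "(g, pmap X (\<lambda>_. b)) \<in> crel X"
    have "(f, pmap X (\<lambda>_. b)) \<in> crel X ^^ (1 + 2)"
      by (rule relpow_trans[OF _ const_const[OF X(2) a(1) b(1)]]) (use a(2) in simp)
    then have "(f, g) \<in> crel X ^^ (1 + 2 + 1)"
      by (rule relpow_trans) (use crel_sym[OF b(2)] in simp)
    then show ?thesis by (rule crel_pow_mono[OF _ f]) simp
  next
    fix A B assume A: "A \<noteq> {}" "A \<subset> X" "(f, pmap A (\<lambda>x. x)) \<in> crel X ^^ 2"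
      and B: "B \<noteq> {}" "B \<subset> X" "(g, pmap B (\<lambda>x. x)) \<in> crel X ^^ 2"
    have "(f, pmap B (\<lambda>x. x)) \<in> crel X ^^ (2 + 1)"
      by (rule relpow_trans[OF A(3)]) (use sub_sub[OF A(1,2) B(1,2)] in simp)
    from relpow_trans[OF this crel_pow_sym[OF B(3)]] show ?thesis by (simp add: numeral_eq_Suc)
  qed (blast intro: const_case crel_pow_sym)+
qed

section \<open>Lollipop maps\<close>

text \<open>On \<open>{..<n}\<close>: a path of length \<open>n - l\<close> leading into a cycle of length \<open>l\<close>.\<close>

definition lolly :: "nat \<Rightarrow> nat \<Rightarrow> nat \<Rightarrow> nat" where
  "lolly n l i = (if Suc i < n then Suc i else n - l)"

lemma lolly_funpow: "i + j < n \<Longrightarrow> (lolly n l ^^ j) i = i + j"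
  by (induction j) (auto simp: lolly_def)

lemma lolly_funpow_less:
  assumes "1 \<le> l" "l \<le> n" "i < n"
  shows "(lolly n l ^^ j) i < n"
  using assms by (induction j) (auto simp: lolly_def)

text \<open>From \<open>i\<close> it takes \<open>p\<close> steps to the last index, one step back
  to \<open>n - l\<close>, and \<open>q\<close> steps up to \<open>i\<close> again.\<close>

lemma lolly_period:
  assumes "1 \<le> l" "l \<le> n" "n - l \<le> i" "i < n"
  shows "(lolly n l ^^ l) i = i"
proof -
  define p q where "p = n - 1 - i" and "q = i - (n - l)"
  have l: "l = q + (Suc p)" using assms by (auto simp: p_def q_def)
  have "(lolly n l ^^ p) i = n - 1" using assms by (subst lolly_funpow) (auto simp: p_def)
  then have "(lolly n l ^^ Suc p) i = n - l" using assms by (simp add: lolly_def)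
  moreover have "(lolly n l ^^ q) (n - l) = i" using assms by (subst lolly_funpow) (auto simp: q_def)
  ultimately show ?thesis using funpow_add[of q "Suc p" "lolly n l"] l by simp
qed

lemma lolly_ge: "min (n - l) (i + j) \<le> (lolly n l ^^ j) i"
  by (induction j) (auto simp: lolly_def)

lemma funpow_mult_fix: "(f ^^ l) x = x \<Longrightarrow> (f ^^ (l * k)) x = x"
  by (induction k) (auto simp: funpow_add)

lemma funpow_funpow: "(f ^^ i) ((f ^^ j) x) = (f ^^ (i + j)) x"
  by (simp add: funpow_add)

text \<open>The orbit of \<open>x\<close> is all of \<open>X\<close>. Hence the domain of a
  commuting map, closed in both directions under \<open>F\<close>, cannot be proper, and the map is
  determined by its value at \<open>x\<close>, which is some \<open>(F ^^ k) x\<close>.\<close>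

lemma generated_centralizer:
  assumes F: "pmap X F \<in> noncentral X" and x: "x \<in> X" "\<And>y. y \<in> X \<Longrightarrow> \<exists>i. y = (F ^^ i) x"
    and g: "(pmap X F, g) \<in> crel X"
  shows "\<exists>k. g = pmap X (F ^^ k)"
proof -
  have "g \<in> noncentral X" using g by (simp add: crel_def)
  then obtain D G where D: "g = pmap D G" "D \<noteq> {}" "D \<subseteq> X" "G ` D \<subseteq> X"
    by (rule noncentral_cases)
  have FX: "F ` X \<subseteq> X" using F by (simp add: pmap_noncentral_iff)
  have c: "\<And>y. y \<in> X \<Longrightarrow> F y \<in> D \<longleftrightarrow> y \<in> D" "\<And>y. y \<in> D \<Longrightarrow> G (F y) = F (G y)"
    using g unfolding D(1) crel_total_iff[OF F] by auto
  have dom: "(F ^^ i) x \<in> D \<longleftrightarrow> x \<in> D" for i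
    using c(1) funpow_closed[OF FX x(1)] by (induction i) auto
  obtain y where "y \<in> D" using D(2) by blast
  then have xD: "x \<in> D" using dom x(2)[of y] D(3) by blast
  have DX: "D = X" using D(3) dom xD x(2) by blast
  obtain k where k: "G x = (F ^^ k) x" using x(2)[of "G x"] D(4) xD by blast
  have "G ((F ^^ i) x) = (F ^^ k) ((F ^^ i) x)" for i
  proof (induction i)
    case (Suc i)
    have "G ((F ^^ Suc i) x) = F (G ((F ^^ i) x))" using c(2) dom xD by simp
    then show ?case using Suc by (simp add: funpow_swap1)
  qed (simp add: k)
  then have "\<forall>y\<in>X. G y = (F ^^ k) y" using x(2) by blast
  then show ?thesis using DX D(1) by (auto simp: pmap_eq_iff)
qed

text \<open>The enumeration \<open>b\<close> lists the points along the path and then around the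
  cycle; \<open>F\<close> is prescribed on \<open>X\<close> only. Allowing \<open>l = n\<close>
  covers full cycles, so both kinds of maps share the description of the centralizer.\<close>

locale lollipop =
  fixes X :: "'a set" and n l :: nat and b :: "nat \<Rightarrow> 'a" and F :: "'a \<Rightarrow> 'a"
  assumes bij: "bij_betw b {..<n} X" and n: "2 \<le> n" and l: "1 \<le> l" "l \<le> n"
    and step: "i < n \<Longrightarrow> F (b i) = b (lolly n l i)"
begin

lemma b_in: "i < n \<Longrightarrow> b i \<in> X"
  using bij by (auto simp: bij_betw_def)

lemma b_eq_iff: "i < n \<Longrightarrow> j < n \<Longrightarrow> b i = b j \<longleftrightarrow> i = j"
  using bij by (auto simp: bij_betw_def inj_on_def)

lemma b_cases:
  assumes "x \<in> X"
  obtains i where "i < n" "x = b i"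
  using assms bij by (auto simp: bij_betw_def)

lemma funpow_b: "i < n \<Longrightarrow> (F ^^ j) (b i) = b ((lolly n l ^^ j) i)"
  using lolly_funpow_less[OF l] step by (induction j) auto

lemma F_closed: "F ` X \<subseteq> X"
  using lolly_funpow_less[OF l, of _ 1] step b_in by (auto elim!: b_cases)

lemma noncentral: "pmap X F \<in> noncentral X"
proof -
  have "F (b 0) \<noteq> b 0" using step[of 0] b_eq_iff[of 1 0] n by (simp add: lolly_def)
  then show ?thesis using F_closed b_in[of 0] n unfolding pmap_noncentral_iff by (metis empty_iff gr0I not_numeral_le_zero order_refl)
qed

lemma centralizer: "(pmap X F, g) \<in> crel X \<Longrightarrow> \<exists>k. g = pmap X (F ^^ k)"
proof (rule generated_centralizer[OF noncentral])
  show "b 0 \<in> X" using b_in n by simp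
  show "\<exists>i. y = (F ^^ i) (b 0)" if "y \<in> X" for y
    using that
  proof (rule b_cases)
    fix i assume "i < n" "y = b i"
    then have "y = (F ^^ i) (b 0)" using funpow_b[of 0 i] lolly_funpow[of 0 i n l] by simp
    then show ?thesis ..
  qed
qed

text \<open>The exponent is a multiple of the cycle length and exceeds the length of the tail, so
  this is the idempotent power of \<open>F\<close> on \<open>X\<close>.\<close>

definition collapse :: "'a \<Rightarrow> 'a" where
  "collapse = F ^^ (l * n)"

lemma collapse_fix: "n - l \<le> i \<Longrightarrow> i < n \<Longrightarrow> collapse (b i) = b i"
  using lolly_period[OF l, where i = i] funpow_mult_fix[where f = "lolly n l" and l = l and x = i and k = n]
  by (simp add: collapse_def funpow_b)

lemma collapse_in:
  assumes "i < n"
  obtains j where "n - l \<le> j" "j < n" "collapse (b i) = b j"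
proof
  have "n \<le> l * n" using l by simp
  then have "min (n - l) (i + l * n) = n - l" by linarith
  then show "n - l \<le> (lolly n l ^^ (l * n)) i" using lolly_ge[of n l i "l * n"] by simp
  show "(lolly n l ^^ (l * n)) i < n" using assms by (rule lolly_funpow_less[OF l])
  show "collapse (b i) = b ((lolly n l ^^ (l * n)) i)" using assms by (simp add: collapse_def funpow_b)
qed

text \<open>\<open>collapse\<close> commutes with \<open>F ^^ l\<close>, which fixes the cycle
  pointwise. Thus \<open>collapse\<close> is computed by raising the index by \<open>l\<close> until
  it lies on the cycle.\<close>

lemma collapse_shift:
  assumes "i + l < n"
  shows "collapse (b (i + l)) = collapse (b i)"
proof -
  have il: "b (i + l) = (F ^^ l) (b i)" using assms by (simp add: funpow_b lolly_funpow)
  have "collapse (b (i + l)) = (F ^^ l) (collapse (b i))"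
    unfolding il collapse_def funpow_funpow by (simp add: add.commute)
  also have "\<dots> = collapse (b i)"
  proof -
    obtain j where j: "n - l \<le> j" "j < n" "collapse (b i) = b j"
      using collapse_in[of i] assms by auto
    then show ?thesis using lolly_period[OF l j(1,2)] by (simp add: funpow_b)
  qed
  finally show ?thesis .
qed

lemma collapse_noncentral:
  assumes "l < n"
  shows "pmap X collapse \<in> noncentral X"
proof -
  obtain j where "n - l \<le> j" "j < n" "collapse (b 0) = b j" using collapse_in[of 0] n by auto
  then have "collapse (b 0) \<noteq> b 0" using b_eq_iff[of j 0] n assms by simp
  moreover have "b 0 \<in> X" using b_in n by simp
  moreover have "collapse ` X \<subseteq> X" using funpow_closed[OF F_closed] by (auto simp: collapse_def)
  ultimately show ?thesis unfolding pmap_noncentral_iff by (metis empty_iff order_refl)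
qed

text \<open>Every nontrivial power of \<open>F\<close> has \<open>collapse\<close> as a power.\<close>

lemma two_step_collapse:
  assumes "l < n" "(pmap X F, g) \<in> crel X" "(g, h) \<in> crel X"
  shows "(pmap X collapse, h) \<in> crel X"
proof -
  obtain k where k: "g = pmap X (F ^^ k)" using centralizer assms(2) by blast
  have "g \<in> noncentral X" using assms(2) by (simp add: crel_def)
  then have "k \<noteq> 0" unfolding k by (auto simp: pmap_noncentral_iff)
  \<comment> \<open>Exchanging exponents turns the left side into \<open>collapse ^^ k\<close>; as
    \<open>k > 0\<close>, the first application lands on fixed points.\<close>
  have collapse_pow: "((F ^^ k) ^^ (l * n)) (b i) = collapse (b i)" if i: "i < n" for i
  proof -
    obtain j where j: "n - l \<le> j" "j < n" "collapse (b i) = b j" using collapse_in[OF i] .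
    have fixed: "(collapse ^^ m) (b j) = b j" for m
      using collapse_fix[OF j(1,2)] by (induction m) auto
    have "((F ^^ k) ^^ (l * n)) (b i) = (collapse ^^ k) (b i)"
      by (simp add: collapse_def funpow_mult mult.commute)
    also have "\<dots> = (collapse ^^ (k - 1)) (collapse (b i))"
      using \<open>k \<noteq> 0\<close> funpow_Suc_right[of "k - 1" collapse] by (metis Suc_pred' comp_apply gr0I diff_Suc_1 Suc_diff_1)
    finally show ?thesis using j(3) fixed by simp
  qed
  then have eq: "pmap X ((F ^^ k) ^^ (l * n)) = pmap X collapse"
    by (auto simp: pmap_eq_iff elim!: b_cases)
  show ?thesis
    using crel_total_funpow[of X "F ^^ k" h "l * n"] assms(3) collapse_noncentral[OF assms(1)]
    unfolding k eq by blast
qed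

end

lemma lollipop_ex:
  assumes "bij_betw b {..<n} X" "2 \<le> n" "1 \<le> l" "l \<le> n"
  obtains F where "lollipop X n l b F"
proof
  show "lollipop X n l b (\<lambda>x. b (lolly n l (inv_into {..<n} b x)))"
    using assms by unfold_locales (auto simp: bij_betw_def)
qed

lemma ex_enum: "finite X \<Longrightarrow> \<exists>b. bij_betw b {..<card X} X"
  using ex_bij_betw_nat_finite[of X] by (simp add: atLeast0LessThan)

section \<open>Full cycles: the prime case and the lower bound four\<close>

locale ncycle = lollipop X n n b F for X :: "'a set" and n b F
begin

lemma funpow_period: "x \<in> X \<Longrightarrow> (F ^^ n) x = x"
  using lolly_period[of n n] n by (auto elim!: b_cases simp: funpow_b)

lemma funpow_mod: "x \<in> X \<Longrightarrow> (F ^^ (k mod n)) x = (F ^^ k) x"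
  by (rule funpow_mod_eq) (rule funpow_period)

lemma funpow_cong:
  assumes "j mod n = k mod n"
  shows "pmap X (F ^^ j) = pmap X (F ^^ k)"
  using assms funpow_mod[of _ j] funpow_mod[of _ k] by (auto simp: pmap_eq_iff)

lemma funpow_noncentral_iff: "pmap X (F ^^ k) \<in> noncentral X \<longleftrightarrow> k mod n \<noteq> 0"
proof
  assume "pmap X (F ^^ k) \<in> noncentral X"
  then show "k mod n \<noteq> 0" using funpow_mod[of _ k] by (auto simp: pmap_noncentral_iff)
next
  assume k: "k mod n \<noteq> 0"
  have "k mod n < n" using n by simp
  then have "(F ^^ (k mod n)) (b 0) = b (k mod n)" using n by (simp add: funpow_b lolly_funpow)
  then have "(F ^^ k) (b 0) \<noteq> b 0"
    using k b_eq_iff[of "k mod n" 0] n funpow_mod[of "b 0" k] b_in[of 0] \<open>k mod n < n\<close> by auto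
  moreover have "b 0 \<in> X" using b_in n by simp
  moreover have "(F ^^ k) ` X \<subseteq> X" using funpow_closed[OF F_closed] by auto
  ultimately show "pmap X (F ^^ k) \<in> noncentral X"
    unfolding pmap_noncentral_iff by (metis empty_iff order_refl)
qed

text \<open>Powers of \<open>F\<close> commute with each other, so a fixed point can be moved along
  the cycle to \<open>b 0\<close>; fixing \<open>b 0\<close> forces \<open>n\<close> to divide
  \<open>k\<close>.\<close>

lemma funpow_fixed_point:
  assumes "x \<in> X" "(F ^^ k) x = x"
  shows "pmap X (F ^^ k) \<notin> noncentral X"
proof -
  obtain i where i: "i < n" "x = b i" using assms(1) by (rule b_cases)
  have bi: "b i = (F ^^ i) (b 0)" using i n by (simp add: funpow_b lolly_funpow)
  have "(F ^^ (n - i)) (b i) = b 0"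
    unfolding bi funpow_funpow using i funpow_period[of "b 0"] b_in[of 0] n by simp
  moreover have "(F ^^ k) ((F ^^ (n - i)) (b i)) = (F ^^ (n - i)) ((F ^^ k) (b i))"
    unfolding funpow_funpow by (simp add: add.commute)
  ultimately have "(F ^^ k) (b 0) = b 0" using assms(2) i by simp
  then have "k mod n = 0"
    using funpow_mod[of "b 0" k] b_in[of 0] n lolly_funpow[of 0 "k mod n" n n] b_eq_iff[of "k mod n" 0]
    by (simp add: funpow_b)
  then show ?thesis by (simp add: funpow_noncentral_iff)
qed

text \<open>For prime \<open>n\<close> a noncentral power \<open>F ^^ k\<close> has an exponent
  invertible modulo \<open>n\<close>, so \<open>F\<close> is in turn a power of it. A neighbour of
  \<open>F ^^ k\<close> therefore commutes with \<open>F\<close> and is again a power of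
  \<open>F\<close>.\<close>

lemma prime_component:
  assumes "prime n" "(f, g) \<in> (crel X)\<^sup>*" "f = pmap X F"
  shows "\<exists>k. g = pmap X (F ^^ k)"
  using assms(2,3)
proof (induction rule: rtrancl_induct)
  case base
  then show ?case by (intro exI[of _ 1]) simp
next
  case (step g h)
  then obtain k where k: "g = pmap X (F ^^ k)" by blast
  have "g \<in> noncentral X" using step.hyps(2) by (simp add: crel_def)
  then have "\<not> n dvd k" unfolding k by (simp add: funpow_noncentral_iff dvd_eq_mod_eq_0)
  then have "coprime k n" using assms(1) prime_imp_coprime coprime_commute by blast
  then obtain j where j: "[k * j = Suc 0] (mod n)" using cong_solve_coprime_nat by blast
  then have "pmap X (F ^^ (k * j)) = pmap X (F ^^ 1)"
    by (intro funpow_cong) (simp add: cong_def)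
  then have eq: "pmap X ((F ^^ k) ^^ j) = pmap X F" by (simp add: funpow_mult)
  have "(pmap X ((F ^^ k) ^^ j), h) \<in> crel X"
    by (rule crel_total_funpow[OF step.hyps(2)[unfolded k]]) (simp add: eq noncentral)
  then show ?case unfolding eq by (rule centralizer)
qed

end

theorem prime_not_connected:
  assumes X: "finite X" "card X \<ge> 2" "prime (card X)"
  shows "\<not> Digraph_Component.connected (cgraph X)"
proof
  assume conn: "Digraph_Component.connected (cgraph X)"
  obtain b where b: "bij_betw b {..<card X} X" using ex_enum[OF X(1)] by blast
  obtain F where "lollipop X (card X) (card X) b F"
    using lollipop_ex[OF b X(2), of "card X"] X(2) by auto
  then interpret ncycle X "card X" b F by (simp add: ncycle_def)
  have x: "b 0 \<in> X" using b_in n by simp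
  have "pmap {b 0} (\<lambda>_. b 0) \<in> noncentral X" by (rule pmap_point_noncentral[OF X(2) x x])
  then obtain k where "pmap {b 0} (\<lambda>_. b 0) = pmap X (F ^^ k)"
    using prime_component[OF X(3) connected_cgraph_imp_rtrancl[OF conn noncentral]] by blast
  then have "X = {b 0}" by (simp add: pmap_eq_iff)
  then have "card X = 1" by (metis is_singletonI is_singleton_altdef)
  then show False using X(2) by simp
qed

text \<open>The collapse of a lollipop with \<open>l = 1\<close> is constant. On a walk of length
  three to a full cycle, the third vertex would commute with this constant and so fix its value, yet
  be a noncentral power of the cycle.\<close>

lemma lower4:
  assumes X: "finite X" "card X \<ge> 2"
  shows "\<exists>f g. f \<in> noncentral X \<and> g \<in> noncentral X \<and> (f, g) \<notin> crel X ^^ 3"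
proof -
  obtain b where b: "bij_betw b {..<card X} X" using ex_enum[OF X(1)] by blast
  obtain F where "lollipop X (card X) (card X) b F"
    using lollipop_ex[OF b X(2), of "card X"] X(2) by auto
  then interpret C: ncycle X "card X" b F by (simp add: ncycle_def)
  obtain H where "lollipop X (card X) 1 b H"
    using lollipop_ex[OF b X(2), of 1] X(2) by auto
  then interpret P: lollipop X "card X" 1 b H .
  let ?x = "b (card X - 1)"
  have x: "?x \<in> X" "P.collapse ?x = ?x" using C.b_in X(2) P.collapse_fix[of "card X - 1"] by simp_all
  have const: "P.collapse y = ?x" if "y \<in> X" for y
    using that
  proof (rule C.b_cases)
    fix i assume i: "i < card X" "y = b i"
    obtain j where "card X - 1 \<le> j" "j < card X" "P.collapse (b i) = b j" using P.collapse_in[OF i(1)] .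
    then show ?thesis using i by (metis One_nat_def Suc_pred' le_antisym less_Suc_eq_le less_nat_zero_code linorder_neqE_nat)
  qed
  have "(pmap X H, pmap X F) \<notin> crel X ^^ 3"
  proof
    assume "(pmap X H, pmap X F) \<in> crel X ^^ 3"
    then obtain g h where gh: "(pmap X H, g) \<in> crel X" "(g, h) \<in> crel X" "(h, pmap X F) \<in> crel X"
      by (auto simp: numeral_3_eq_3)
    have "(pmap X P.collapse, h) \<in> crel X" using P.two_step_collapse[OF _ gh(1,2)] X(2) by simp
    moreover obtain k where k: "h = pmap X (F ^^ k)" using C.centralizer[OF crel_sym[OF gh(3)]] by blast
    ultimately have "(F ^^ k) (P.collapse ?x) = P.collapse ((F ^^ k) ?x)"
      using crel_total_iff[OF P.collapse_noncentral] X(2) x(1) by simp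
    then have "(F ^^ k) ?x = ?x" using const x funpow_closed[OF C.F_closed x(1)] by simp
    then have "h \<notin> noncentral X" using C.funpow_fixed_point[OF x(1)] k by simp
    then show False using gh(3) by (simp add: crel_def)
  qed
  then show ?thesis using P.noncentral C.noncentral by blast
qed

section \<open>Two maps at distance five\<close>

text \<open>
  The points of \<open>X\<close> are labelled \<open>h\<^sub>v = v\<close> and \<open>t\<^sub>v = m + v\<close> for \<open>v < m\<close>, \<open>s = 2m\<close>,
  \<open>r = 2m + 1\<close> and, for odd \<open>n\<close>, \<open>q = 2m + 2\<close>. The first idempotent maps \<open>h\<^sub>v\<close> to \<open>t\<^sub>v\<close>
  and \<open>r, q\<close> to \<open>s\<close>; the second maps \<open>t\<^sub>v\<close> to \<open>h\<^bsub>v+1\<^esub>\<close> (cyclically), \<open>s\<close> to \<open>h\<^sub>0\<close>,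
  \<open>r\<close> to \<open>h\<^sub>1\<close> and \<open>q\<close> to \<open>h\<^bsub>m-1\<^esub>\<close>. Hence a common commuting map acts on the \<open>h\<^sub>v\<close>
  and \<open>t\<^sub>v\<close> as a rotation, and \<open>s\<close> and \<open>r\<close> force this rotation to be trivial.
\<close>

definition theta1 :: "nat \<Rightarrow> nat \<Rightarrow> nat" where
  "theta1 m v = (if v < m then m + v else if v < 2 * m then v else 2 * m)"

definition theta2 :: "nat \<Rightarrow> nat \<Rightarrow> nat" where
  "theta2 m v = (if v < m then v else if v < 2 * m then (if Suc v = 2 * m then 0 else Suc v - m)
     else if v = 2 * m then 0 else if v = 2 * m + 1 then 1 else m - 1)"

lemma theta_rigid:
  assumes m: "3 \<le> m" and n: "n = 2 * m + 2 \<or> n = 2 * m + 3"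
    and g: "\<And>v. v < n \<Longrightarrow> g v < n"
    and g1: "\<And>v. v < n \<Longrightarrow> g (theta1 m v) = theta1 m (g v)"
    and g2: "\<And>v. v < n \<Longrightarrow> g (theta2 m v) = theta2 m (g v)"
    and v: "v < n"
  shows "g v = v"
proof -
  define k where "k = g 0"
  \<comment> \<open>\<open>theta2\<close> fixes 0, so \<open>g 0\<close> is a fixed point of
    \<open>theta2\<close> as well, and the image of \<open>theta2\<close> lies below
    \<open>m\<close>.\<close>
  have k: "k < m" using g2[of 0] n m unfolding k_def[symmetric] by (auto simp: theta2_def k_def split: if_splits)
  \<comment> \<open>\<open>theta1\<close> followed by \<open>theta2\<close> takes each label
    \<open>v < m\<close> to its cyclic successor, so \<open>g\<close> acts there as the rotation by
    \<open>k\<close>.\<close>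
  have head: "g v = (if v + k < m then v + k else v + k - m)" if "v < m" for v
    using that
  proof (induction v)
    case 0
    then show ?case using k by (simp add: k_def)
  next
    case (Suc v)
    have gv: "g v = (if v + k < m then v + k else v + k - m)" using Suc by simp
    then have "g v < m" using k Suc.prems by auto
    then have "g (m + v) = m + g v" using g1[of v] n Suc.prems by (auto simp: theta1_def)
    moreover have "theta2 m (m + v) = Suc v" using Suc.prems by (auto simp: theta2_def)
    ultimately have "g (Suc v) = theta2 m (m + g v)" using g2[of "m + v"] n Suc.prems by auto
    then show ?case using \<open>g v < m\<close> gv k Suc.prems by (auto simp: theta2_def)
  qed
  have tail: "g (m + v) = m + g v" if "v < m" for v
  proof -
    have "g v < m" using head[OF that] that k by auto
    then show ?thesis using g1[of v] n that by (auto simp: theta1_def)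
  qed
  have s: "theta1 m (g (2 * m)) = g (2 * m)" "theta2 m (g (2 * m)) = k"
    using g1[of "2 * m"] g2[of "2 * m"] n by (auto simp: theta1_def theta2_def k_def)
  have r: "theta1 m (g (2 * m + 1)) = g (2 * m)" "theta2 m (g (2 * m + 1)) = g 1"
    using g1[of "2 * m + 1"] g2[of "2 * m + 1"] n by (auto simp: theta1_def theta2_def)
  have g1_eq: "g 1 = (if 1 + k < m then 1 + k else 0)" using head[of 1] m k by auto
  \<comment> \<open>If the image of \<open>s\<close> were \<open>m + j\<close>, then
    \<open>k\<close> would be \<open>j + 1\<close> modulo \<open>m\<close>. The image of
    \<open>r\<close> would be \<open>j\<close> or \<open>m + j\<close>, which \<open>theta2\<close>
    sends to \<open>j\<close> or \<open>j + 1\<close>, whereas \<open>g 1\<close> is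
    \<open>j + 2\<close>, all modulo \<open>m\<close>. These differ because
    \<open>m \<ge> 3\<close>.\<close>
  have "\<not> (m \<le> g (2 * m) \<and> g (2 * m) < 2 * m)"
  proof
    assume "m \<le> g (2 * m) \<and> g (2 * m) < 2 * m"
    then obtain j where j: "g (2 * m) = m + j" "j < m" using le_Suc_ex by fastforce
    then have k_eq: "k = (if Suc j = m then 0 else Suc j)" using s(2) by (auto simp: theta2_def split: if_splits)
    have "g (2 * m + 1) = j \<or> g (2 * m + 1) = m + j"
      using r(1) j by (auto simp: theta1_def split: if_splits)
    then show False using r(2) j(2) k_eq g1_eq m by (auto simp: theta2_def split: if_splits)
  qed
  then have s2: "g (2 * m) = 2 * m" using s(1) by (auto simp: theta1_def split: if_splits)
  then have k0: "k = 0" using s(2) by (auto simp: theta2_def)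
  \<comment> \<open>The image of \<open>r\<close> now lies in the \<open>theta1\<close>-fibre of
    \<open>s\<close>, whose points \<open>s\<close>, \<open>r\<close>, \<open>q\<close> are
    separated by the \<open>theta2\<close>-values 0, 1 and \<open>m - 1\<close>.\<close>
  have r2: "g (2 * m + 1) = 2 * m + 1"
  proof -
    have large: "2 * m \<le> w" if "theta1 m w = 2 * m" for w
      using that by (simp add: theta1_def split: if_splits)
    have one: "w = 2 * m + 1" if "theta2 m w = 1" "2 * m \<le> w" for w
    proof (rule ccontr)
      assume "w \<noteq> 2 * m + 1"
      then have "theta2 m w = (if w = 2 * m then 0 else m - 1)"
        using that(2) m by (simp add: theta2_def)
      then show False using that(1) m by (cases "w = 2 * m") simp_all
    qed
    have "theta1 m (g (2 * m + 1)) = 2 * m" using r(1) s2 by (rule trans)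
    moreover have "g 1 = 1" unfolding g1_eq k0 using m by simp
    then have "theta2 m (g (2 * m + 1)) = 1" unfolding r(2) .
    ultimately show ?thesis using large one by blast
  qed
  have q2: "g (2 * m + 2) = 2 * m + 2" if q: "2 * m + 2 < n"
  proof -
    have "theta1 m (g (2 * m + 2)) = 2 * m" "theta2 m (g (2 * m + 2)) = m - 1" "g (2 * m + 2) < 2 * m + 3"
      using g1[OF q] g2[OF q] s2 head[of "m - 1"] k0 m g[OF q] n by (auto simp: theta1_def theta2_def)
    then show ?thesis using m by (auto simp: theta1_def theta2_def split: if_splits)
  qed
  consider "v < m" | "m \<le> v" "v < 2 * m" | "v = 2 * m" | "v = 2 * m + 1" | "v = 2 * m + 2"
    using v n by linarith
  then show ?thesis
  proof cases
    case 1
    then show ?thesis using head k0 by simp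
  next
    case 2
    then show ?thesis using tail[of "v - m"] head[of "v - m"] k0 by auto
  qed (use s2 r2 q2 v in auto)
qed

text \<open>Reduces common centralizers of total maps to self-maps of an index set.\<close>

lemma common_centralizer_trivial:
  assumes c: "bij_betw c {..<n} X"
    and conn: "\<And>P. (\<And>k v. k \<in> K \<Longrightarrow> v < n \<Longrightarrow> P (e k v) \<longleftrightarrow> P v) \<Longrightarrow> \<forall>v<n. \<forall>w<n. P v \<longrightarrow> P w"
    and rigid: "\<And>g v. (\<And>v. v < n \<Longrightarrow> g v < n) \<Longrightarrow>
      (\<And>k v. k \<in> K \<Longrightarrow> v < n \<Longrightarrow> g (e k v) = e k (g v)) \<Longrightarrow> v < n \<Longrightarrow> g v = v"
    and e: "\<And>k v. k \<in> K \<Longrightarrow> v < n \<Longrightarrow> e k v < n"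
    and E: "\<And>k v. k \<in> K \<Longrightarrow> v < n \<Longrightarrow> E k (c v) = c (e k v)"
    and comm: "\<And>k. k \<in> K \<Longrightarrow> (pmap X (E k), f) \<in> crel X" and f: "f \<in> noncentral X"
  shows False
proof -
  obtain D G where D: "f = pmap D G" "D \<noteq> {}" "D \<subseteq> X" "G ` D \<subseteq> X" "\<not> (D = X \<and> (\<forall>x\<in>X. G x = x))"
    using f by (rule noncentral_cases)
  have X: "X = c ` {..<n}" using c by (simp add: bij_betw_def)
  have inj: "c v = c w \<longleftrightarrow> v = w" if "v < n" "w < n" for v w
    using c that by (auto simp: bij_betw_def inj_on_def)
  have dom: "c (e k v) \<in> D \<longleftrightarrow> c v \<in> D" and eqv: "c v \<in> D \<Longrightarrow> G (c (e k v)) = E k (G (c v))"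
    if "k \<in> K" "v < n" for k v
  proof -
    have nc: "pmap X (E k) \<in> noncentral X" using comm[OF that(1)] by (simp add: crel_def)
    have "c v \<in> X" using that(2) X by blast
    then show "c (e k v) \<in> D \<longleftrightarrow> c v \<in> D" "c v \<in> D \<Longrightarrow> G (c (e k v)) = E k (G (c v))"
      using comm[OF that(1)] E[OF that] unfolding D(1) crel_total_iff[OF nc] by metis+
  qed
  obtain v where v: "v < n" "c v \<in> D" using D(2,3) X by blast
  \<comment> \<open>Connectedness applied to membership in the domain excludes properly partial
    maps.\<close>
  have all: "c w \<in> D" if "w < n" for w
    using conn[of "\<lambda>v. c v \<in> D"] dom v that by blast
  then have DX: "D = X" using D(3) X by blast
  define g where "g v = inv_into {..<n} c (G (c v))" for v
  have g: "g v < n" "c (g v) = G (c v)" if "v < n" for v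
  proof -
    have "G (c v) \<in> c ` {..<n}" using all[OF that] D(4) X by blast
    then show "g v < n" "c (g v) = G (c v)"
      using inv_into_into[of "G (c v)" c "{..<n}"] f_inv_into_f[of "G (c v)" c "{..<n}"]
      by (auto simp: g_def)
  qed
  have "g (e k v) = e k (g v)" if kv: "k \<in> K" "v < n" for k v
  proof -
    have "c (g (e k v)) = G (c (e k v))" using g e kv by simp
    also have "\<dots> = E k (c (g v))" using eqv[OF kv all[OF kv(2)]] g(2)[OF kv(2)] by simp
    also have "\<dots> = c (e k (g v))" using E[OF kv(1)] g(1)[OF kv(2)] by simp
    finally show ?thesis using inj[of "g (e k v)" "e k (g v)"] g(1) e kv by simp
  qed
  then have "g v = v" if "v < n" for v using rigid[of g v] g(1) that by blast
  then have "G x = x" if "x \<in> X" for x using g(2) that X by auto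
  then show False using D(5) DX by blast
qed

text \<open>\<open>theta2\<close> joins every point to a label below \<open>m\<close>, and these
  labels are joined in succession by \<open>theta1\<close> followed by
  \<open>theta2\<close>.\<close>

lemma theta_connected:
  assumes m: "3 \<le> m" and n: "n = 2 * m + 2 \<or> n = 2 * m + 3"
    and P1: "\<And>v. v < n \<Longrightarrow> P (theta1 m v) \<longleftrightarrow> P v"
    and P2: "\<And>v. v < n \<Longrightarrow> P (theta2 m v) \<longleftrightarrow> P v"
    and v: "v < n"
  shows "P v \<longleftrightarrow> P 0"
proof -
  have head: "P v \<longleftrightarrow> P 0" if "v < m" for v
    using that
  proof (induction v)
    case (Suc v)
    have "theta1 m v = m + v" "theta2 m (m + v) = Suc v"
      using Suc.prems by (auto simp: theta1_def theta2_def)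
    then have "P (Suc v) \<longleftrightarrow> P v" using P1[of v] P2[of "m + v"] n Suc.prems by auto
    then show ?case using Suc by simp
  qed simp
  have "theta2 m v < m" using m by (auto simp: theta2_def)
  then show ?thesis using head P2[OF v] by blast
qed

lemma bij_betw_compose_index:
  assumes "bij_betw c {..<n} X" "p ` {..<n} \<subseteq> {..<n}" "inj_on p {..<n}"
  shows "bij_betw (\<lambda>i. c (p i)) {..<n::nat} X"
proof -
  have "bij_betw p {..<n} {..<n}" using assms endo_inj_surj[of "{..<n}" p] by (simp add: bij_betw_def)
  from bij_betw_trans[OF this assms(1)] show ?thesis by (simp add: comp_def)
qed

context lollipop
begin

lemma collapse_one: "n - l \<le> i + l \<Longrightarrow> i + l < n \<Longrightarrow> collapse (b i) = b (i + l)"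
  using collapse_shift[of i] collapse_fix[of "i + l"] by simp

lemma collapse_two: "n - l \<le> i + l + l \<Longrightarrow> i + l + l < n \<Longrightarrow> collapse (b i) = b (i + l + l)"
  using collapse_shift[of i] collapse_one[of "i + l"] by simp

end

text \<open>
  The orders along the two lollipops, where \<open>d\<close> is \<open>0\<close> or \<open>1\<close> and \<open>q\<close> is present only for \<open>d = 1\<close>:
  \<open>q, h\<^sub>0, \<dots>, h\<^bsub>m-1\<^esub>, r, t\<^sub>0, \<dots>, t\<^bsub>m-1\<^esub>, s\<close> with a cycle of length \<open>m + 1\<close> and
  \<open>q, s, r, t\<^sub>1, \<dots>, t\<^bsub>m-1\<^esub>, t\<^sub>0, h\<^sub>2, \<dots>, h\<^bsub>m-1\<^esub>, h\<^sub>0, h\<^sub>1\<close> with a cycle of length \<open>m\<close>.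
\<close>

definition path1 :: "nat \<Rightarrow> nat \<Rightarrow> nat \<Rightarrow> nat" where
  "path1 d m i = (if i < d then 2 * m + 2 else if i < d + m then i - d else if i = d + m then 2 * m + 1
     else if i \<le> d + 2 * m then i - d - 1 else 2 * m)"

definition path2 :: "nat \<Rightarrow> nat \<Rightarrow> nat \<Rightarrow> nat" where
  "path2 d m i = (if i < d then 2 * m + 2 else if i \<le> d + 1 then 2 * m + (i - d)
     else if i \<le> d + m then i - d + m - 1 else if i = d + m + 1 then m
     else if i < d + 2 * m then i - d - m else i - d - 2 * m)"

text \<open>Explicit left inverse of \<open>path2\<close>, through which injectivity follows without
  comparing cases in pairs.\<close>

definition path2_pos :: "nat \<Rightarrow> nat \<Rightarrow> nat \<Rightarrow> nat" where
  "path2_pos d m v = (if v = 0 then d + 2 * m else if v = 1 then d + 2 * m + 1 else if v < m then d + m + v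
    else if v = m then d + m + 1 else if v < 2 * m then d + v - m + 1 else if v = 2 * m then d
    else if v = 2 * m + 1 then d + 1 else 0)"

lemma path2_less: "3 \<le> m \<Longrightarrow> d \<le> 1 \<Longrightarrow> i < 2 * m + 2 + d \<Longrightarrow> path2 d m i < 2 * m + 2 + d"
  unfolding path2_def by (simp split: if_split) linarith

lemma path2_inverse:
  assumes "3 \<le> m" "d \<le> 1" "i \<in> {..<2 * m + 2 + d}"
  shows "path2_pos d m (path2 d m i) = i"
proof -
  \<comment> \<open>The blocks of the second order: \<open>q\<close>; \<open>s\<close>;
    \<open>r\<close>; \<open>t\<close> from 1 to \<open>m - 1\<close>; \<open>t\<close> at 0;
    \<open>h\<close> from 2 to \<open>m - 1\<close>; \<open>h\<close> at 0; \<open>h\<close> at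
    1.\<close>
  consider "i < d" | "i = d" | "i = d + 1" | j where "i = d + 2 + j" "j + 1 < m" | "i = d + m + 1"
    | j where "i = d + m + 2 + j" "j + 2 < m" | "i = d + 2 * m" | "i = d + 2 * m + 1"
  proof -
    have "i < d \<or> i = d \<or> i = d + 1 \<or> (\<exists>j. i = d + 2 + j \<and> j + 1 < m) \<or> i = d + m + 1 \<or>
      (\<exists>j. i = d + m + 2 + j \<and> j + 2 < m) \<or> i = d + 2 * m \<or> i = d + 2 * m + 1"
      using assms unfolding lessThan_iff by presburger
    then show thesis using that by blast
  qed
  then show ?thesis by cases (use assms in \<open>simp_all add: path2_def path2_pos_def\<close>)
qed

text \<open>The order places each point either on the cycle or exactly one or two cycle lengths
  before its image under \<open>theta1\<close>. The second order does the same for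
  \<open>theta2\<close>.\<close>

lemma path1_collapse:
  assumes "lollipop X (2 * m + 2 + d) (m + 1) (\<lambda>i. c (path1 d m i)) F" "3 \<le> m" "d \<le> 1"
    and v: "v < 2 * m + 2 + d"
  shows "lollipop.collapse (2 * m + 2 + d) (m + 1) F (c v) = c (theta1 m v)"
proof -
  interpret lollipop X "2 * m + 2 + d" "m + 1" "\<lambda>i. c (path1 d m i)" F by fact
  consider "v < m" | "m \<le> v" "v < 2 * m" | "v = 2 * m" | "v = 2 * m + 1" | "v = 2 * m + 2" "d = 1"
    using v assms(3) by linarith
  then show ?thesis
  proof cases
    case 1
    then show ?thesis using collapse_one[of "d + v"] by (simp add: path1_def theta1_def add.commute)
  next
    case 2
    then show ?thesis using collapse_fix[of "d + v + 1"] by (simp add: path1_def theta1_def)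
  next
    case 3
    then show ?thesis using collapse_fix[of "d + 2 * m + 1"] by (simp add: path1_def theta1_def)
  next
    case 4
    then show ?thesis using collapse_one[of "d + m"] by (simp add: path1_def theta1_def)
  next
    case 5
    then show ?thesis using collapse_two[of 0] by (simp add: path1_def theta1_def)
  qed
qed

lemma path2_collapse:
  assumes "lollipop X (2 * m + 2 + d) m (\<lambda>i. c (path2 d m i)) F" "3 \<le> m" "d \<le> 1"
    and v: "v < 2 * m + 2 + d"
  shows "lollipop.collapse (2 * m + 2 + d) m F (c v) = c (theta2 m v)"
proof -
  interpret lollipop X "2 * m + 2 + d" m "\<lambda>i. c (path2 d m i)" F by fact
  consider "v = 0" | "v = 1" | "2 \<le> v" "v < m" | "v = m" | "m < v" "Suc v < 2 * m" | "Suc v = 2 * m"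
    | "v = 2 * m" | "v = 2 * m + 1" | "v = 2 * m + 2" "d = 1"
    using v assms(3) by linarith
  then show ?thesis
  proof cases
    case 1
    then show ?thesis using collapse_fix[of "d + 2 * m"] assms(2) by (simp add: path2_def theta2_def)
  next
    case 2
    then show ?thesis using collapse_fix[of "d + 2 * m + 1"] assms(2) by (simp add: path2_def theta2_def)
  next
    case 3
    then show ?thesis using collapse_fix[of "d + m + v"] assms(2) by (simp add: path2_def theta2_def)
  next
    case 4
    then show ?thesis using collapse_one[of "d + m + 1"] assms(2) by (simp add: path2_def theta2_def)
  next
    case 5
    then obtain u where "v = m + u" "1 \<le> u" "Suc u < m" using le_Suc_ex[of m v] by auto
    then show ?thesis using collapse_one[of "d + u + 1"] by (simp add: path2_def theta2_def add.commute)
  next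
    case 6
    then have "v = m + m - Suc 0" by simp
    then show ?thesis using collapse_one[of "d + m"] assms(2) by (simp add: path2_def theta2_def)
  next
    case 7
    then show ?thesis using collapse_two[of d] assms(2) by (simp add: path2_def theta2_def)
  next
    case 8
    then show ?thesis using collapse_two[of "d + 1"] assms(2) by (simp add: path2_def theta2_def)
  next
    case 9
    then show ?thesis using collapse_two[of 0] assms(2,3) by (simp add: path2_def theta2_def)
  qed
qed

lemma relpow_4E:
  assumes "(x, y) \<in> R ^^ 4"
  obtains u v w where "(x, u) \<in> R" "(u, v) \<in> R" "(v, w) \<in> R" "(w, y) \<in> R"
  using assms by (auto simp: numeral_eq_Suc)

text \<open>The middle vertex of a walk of length four is two steps from each lollipop, so it
  commutes with both collapses, which are \<open>theta1\<close> and \<open>theta2\<close> in the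
  labelling \<open>c\<close>. Rigidity and connectedness leave no noncentral map of this
  kind.\<close>

lemma lower5_ge8:
  assumes X: "finite X" "card X \<ge> 8"
  shows "\<exists>f g. f \<in> noncentral X \<and> g \<in> noncentral X \<and> (f, g) \<notin> crel X ^^ 4"
proof -
  define m d where "m = (card X - 2) div 2" and "d = card X mod 2"
  have m: "3 \<le> m" and d: "d \<le> 1" and n: "card X = 2 * m + 2 + d"
    using X(2) by (auto simp: m_def d_def) presburger+
  obtain c where c: "bij_betw c {..<2 * m + 2 + d} X" using ex_enum[OF X(1)] n by auto
  have "bij_betw (\<lambda>i. c (path1 d m i)) {..<2 * m + 2 + d} X"
    using m d by (intro bij_betw_compose_index[OF c]) (auto simp: inj_on_def path1_def split: if_splits)
  from lollipop_ex[OF this, of "m + 1"]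
  obtain F1 where F1: "lollipop X (2 * m + 2 + d) (m + 1) (\<lambda>i. c (path1 d m i)) F1"
    by auto
  have "bij_betw (\<lambda>i. c (path2 d m i)) {..<2 * m + 2 + d} X"
    using path2_less[OF m d] path2_inverse[OF m d]
    by (intro bij_betw_compose_index[OF c] inj_on_inverseI[of _ "path2_pos d m"]) auto
  from lollipop_ex[OF this, of m]
  obtain F2 where F2: "lollipop X (2 * m + 2 + d) m (\<lambda>i. c (path2 d m i)) F2"
    using m by auto
  interpret L1: lollipop X "2 * m + 2 + d" "m + 1" "\<lambda>i. c (path1 d m i)" F1 by (rule F1)
  interpret L2: lollipop X "2 * m + 2 + d" m "\<lambda>i. c (path2 d m i)" F2 by (rule F2)
  have n': "2 * m + 2 + d = 2 * m + 2 \<or> 2 * m + 2 + d = 2 * m + 3" using d by auto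
  have "(pmap X F1, pmap X F2) \<notin> crel X ^^ 4"
  proof
    assume "(pmap X F1, pmap X F2) \<in> crel X ^^ 4"
    then obtain u v w where uvw: "(pmap X F1, u) \<in> crel X" "(u, v) \<in> crel X" "(v, w) \<in> crel X"
      "(w, pmap X F2) \<in> crel X" by (rule relpow_4E)
    have v: "(pmap X L1.collapse, v) \<in> crel X" "(pmap X L2.collapse, v) \<in> crel X"
      using L1.two_step_collapse[OF _ uvw(1,2)]
        L2.two_step_collapse[OF _ crel_sym[OF uvw(4)] crel_sym[OF uvw(3)]] m by simp_all
    show False
    proof (rule common_centralizer_trivial[OF c, of UNIV
          "\<lambda>k. if k then theta1 m else theta2 m" "\<lambda>k. if k then L1.collapse else L2.collapse" v])
      show "v \<in> noncentral X" using v by (simp add: crel_def)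
      show "(if k then theta1 m else theta2 m) i < 2 * m + 2 + d" for k i
        using m by (auto simp: theta1_def theta2_def)
      show "(if k then L1.collapse else L2.collapse) (c i) = c ((if k then theta1 m else theta2 m) i)"
        if "i < 2 * m + 2 + d" for k i
        using path1_collapse[OF F1 m d that] path2_collapse[OF F2 m d that] by simp
      show "(pmap X (if k then L1.collapse else L2.collapse), v) \<in> crel X" for k using v by simp
    next
      fix P :: "nat \<Rightarrow> bool"
      assume P: "\<And>k i. k \<in> UNIV \<Longrightarrow> i < 2 * m + 2 + d \<Longrightarrow> P ((if k then theta1 m else theta2 m) i) \<longleftrightarrow> P i"
      have "P i \<longleftrightarrow> P 0" if "i < 2 * m + 2 + d" for i
        by (rule theta_connected[OF m n' _ _ that]) (use P[of True] P[of False] in simp_all)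
      then show "\<forall>i<2 * m + 2 + d. \<forall>j<2 * m + 2 + d. P i \<longrightarrow> P j" by blast
    next
      fix g :: "nat \<Rightarrow> nat" and i
      assume g: "\<And>i. i < 2 * m + 2 + d \<Longrightarrow> g i < 2 * m + 2 + d"
        "\<And>k i. k \<in> UNIV \<Longrightarrow> i < 2 * m + 2 + d \<Longrightarrow>
          g ((if k then theta1 m else theta2 m) i) = (if k then theta1 m else theta2 m) (g i)"
        "i < 2 * m + 2 + d"
      show "g i = i"
        by (rule theta_rigid[OF m n' _ _ _ g(3)]) (use g(1) g(2)[of True] g(2)[of False] in simp_all)
    qed
  qed
  then show ?thesis using L1.noncentral L2.noncentral by blast
qed

text \<open>
  The pair for six points, found by search: the points are numbered along the 6-cycle, and
  \<open>six_path\<close> is the order along the lollipop.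
\<close>

definition six_path :: "nat \<Rightarrow> nat" where
  "six_path i = [4, 5, 2, 0, 3, 1] ! i"

text \<open>The collapse of that lollipop: 4, 5 and 2 go to the cycle points 0, 3 and 1 three places
  later in \<open>six_path\<close>.\<close>

definition six_collapse :: "nat \<Rightarrow> nat" where
  "six_collapse i = [0, 1, 1, 3, 0, 3] ! i"

lemma less_6_cases: "i < (6::nat) \<longleftrightarrow> i = 0 \<or> i = 1 \<or> i = 2 \<or> i = 3 \<or> i = 4 \<or> i = 5"
  by auto

lemma all_less_6: "(\<forall>i<6. Q i) \<longleftrightarrow> Q 0 \<and> Q 1 \<and> Q 2 \<and> Q 3 \<and> Q 4 \<and> Q (5::nat)"
  by (simp add: numeral_eq_Suc All_less_Suc conj_ac)

text \<open>Commuting with the collapse puts \<open>g 0\<close> and \<open>g 1\<close> into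
  \<open>{0, 1, 3}\<close>. Rotation by 2 determines \<open>g\<close> from these two values,
  rotation by 3 from these and \<open>g 2\<close>, leaving a finite check.\<close>

lemma six_rigid:
  assumes g: "\<And>v. v < 6 \<Longrightarrow> g v < 6"
    and g1: "\<And>v. v < 6 \<Longrightarrow> g (six_collapse v) = six_collapse (g v)"
    and g2: "\<And>v. v < 6 \<Longrightarrow> g ((v + q) mod 6) = (g v + q) mod 6"
    and q: "q = 2 \<or> q = 3" and v: "v < 6"
  shows "g v = v"
proof -
  have e: "six_collapse (g 0) = g 0" "six_collapse (g 1) = g 1" "six_collapse (g 2) = g 1"
    "six_collapse (g 3) = g 3" "six_collapse (g 4) = g 0" "six_collapse (g 5) = g 3"
    using g1[of 0] g1[of 1] g1[of 2] g1[of 3] g1[of 4] g1[of 5] by (simp_all add: six_collapse_def)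
  have a: "g 0 = 0 \<or> g 0 = 1 \<or> g 0 = 3" "g 1 = 0 \<or> g 1 = 1 \<or> g 1 = 3"
    using e(1,2) g[of 0] g[of 1] by (auto simp: less_6_cases six_collapse_def)
  have "\<forall>v<6. g v = v"
    using q
  proof
    assume q2: "q = 2"
    have "g 2 = (g 0 + 2) mod 6" "g 4 = (g 2 + 2) mod 6" "g 3 = (g 1 + 2) mod 6" "g 5 = (g 3 + 2) mod 6"
      using g2[of 0] g2[of 2] g2[of 1] g2[of 3] unfolding q2
      by (simp_all del: add_2_eq_Suc add_2_eq_Suc' One_nat_def)
    with a e show ?thesis unfolding all_less_6 by (elim disjE) (simp_all add: six_collapse_def)
  next
    assume q3: "q = 3"
    have b: "g 3 = (g 0 + 3) mod 6" "g 4 = (g 1 + 3) mod 6" "g 5 = (g 2 + 3) mod 6"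
      using g2[of 0] g2[of 1] g2[of 2] unfolding q3 by simp_all
    have "g 2 = 0 \<or> g 2 = 1 \<or> g 2 = 2 \<or> g 2 = 3 \<or> g 2 = 4 \<or> g 2 = 5"
      using g[of 2] by (simp add: less_6_cases)
    with a e b show ?thesis unfolding all_less_6 by (elim disjE) (simp_all add: six_collapse_def)
  qed
  then show ?thesis using v by blast
qed

lemma six_connected:
  assumes P1: "\<And>v. v < 6 \<Longrightarrow> P (six_collapse v) \<longleftrightarrow> P v"
    and P2: "\<And>v. v < 6 \<Longrightarrow> P ((v + q) mod 6) \<longleftrightarrow> P v"
    and q: "q = 2 \<or> q = 3" and v: "v < (6::nat)"
  shows "P v \<longleftrightarrow> P 0"
proof -
  have "P 1 \<longleftrightarrow> P 2" "P 0 \<longleftrightarrow> P 4" "P 3 \<longleftrightarrow> P 5"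
    using P1[of 2] P1[of 4] P1[of 5] by (simp_all add: six_collapse_def)
  moreover have "P 2 \<longleftrightarrow> P 0" "P 3 \<longleftrightarrow> P 1" if "q = 2"
    using P2[of 0] P2[of 1] that by (simp_all del: add_2_eq_Suc add_2_eq_Suc' One_nat_def)
  moreover have "P 3 \<longleftrightarrow> P 0" "P 4 \<longleftrightarrow> P 1" if "q = 3"
    using P2[of 0] P2[of 1] that by simp_all
  ultimately have "\<forall>v<6. P v \<longleftrightarrow> P 0" unfolding all_less_6 using q by metis
  then show ?thesis using v by blast
qed

lemma lower5_6:
  assumes X: "finite X" "card X = 6"
  shows "\<exists>f g. f \<in> noncentral X \<and> g \<in> noncentral X \<and> (f, g) \<notin> crel X ^^ 4"
proof -
  obtain c :: "nat \<Rightarrow> 'a" where c: "bij_betw c {..<6} X" using ex_enum[OF X(1)] X(2) by auto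
  have "bij_betw (\<lambda>i. c (six_path i)) {..<6} X"
    by (intro bij_betw_compose_index[OF c]) (auto simp: inj_on_def six_path_def less_6_cases)
  from lollipop_ex[OF this, of 3] obtain H where H: "lollipop X 6 3 (\<lambda>i. c (six_path i)) H" by auto
  interpret L: lollipop X 6 3 "\<lambda>i. c (six_path i)" H by (rule H)
  from lollipop_ex[OF c, of 6] obtain F where "lollipop X 6 6 c F" by auto
  then interpret C: ncycle X 6 c F by (simp add: ncycle_def)
  have collapse: "L.collapse (c i) = c (six_collapse i)" if "i < 6" for i
  proof -
    have "\<forall>i<6. L.collapse (c i) = c (six_collapse i)"
      unfolding all_less_6 six_collapse_def
      using L.collapse_one[of 0] L.collapse_one[of 1] L.collapse_one[of 2]
        L.collapse_fix[of 3] L.collapse_fix[of 4] L.collapse_fix[of 5]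
      by (simp add: six_path_def)
    then show ?thesis using that by blast
  qed
  have lolly6: "lolly 6 6 i = Suc i mod 6" if "i < 6" for i
    using that by (auto simp: lolly_def less_6_cases)
  have rot: "(F ^^ j) (c i) = c ((i + j) mod 6)" if "i < 6" for i j
  proof (induction j)
    case (Suc j)
    then show ?case using C.step[of "(i + j) mod 6"] lolly6[of "(i + j) mod 6"] by (simp add: mod_Suc_eq)
  qed (use that in simp)
  have "(pmap X H, pmap X F) \<notin> crel X ^^ 4"
  proof
    assume "(pmap X H, pmap X F) \<in> crel X ^^ 4"
    then obtain u v w where uvw: "(pmap X H, u) \<in> crel X" "(u, v) \<in> crel X" "(v, w) \<in> crel X"
      "(w, pmap X F) \<in> crel X" by (rule relpow_4E)
    have v1: "(pmap X L.collapse, v) \<in> crel X" using L.two_step_collapse[OF _ uvw(1,2)] by simp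
    obtain j where j: "w = pmap X (F ^^ j)" using C.centralizer[OF crel_sym[OF uvw(4)]] by blast
    have "w \<in> noncentral X" using uvw by (simp add: crel_def)
    then have "j mod 6 \<noteq> 0" unfolding j by (simp add: C.funpow_noncentral_iff)
    \<comment> \<open>Each nontrivial subgroup of the integers modulo 6 contains 2 or 3, so some
      power of \<open>w\<close> is the rotation by 2 or by 3.\<close>
    then have "\<exists>k q. (q = 2 \<or> q = 3) \<and> (j * k) mod 6 = q mod 6"
    proof -
      have "j mod 6 = 1 \<or> j mod 6 = 2 \<or> j mod 6 = 3 \<or> j mod 6 = 4 \<or> j mod 6 = 5"
        using \<open>j mod 6 \<noteq> 0\<close> less_6_cases[of "j mod 6"] by simp
      then have "(j mod 6) * 2 mod 6 = 2 \<or> (j mod 6) * 1 mod 6 = 2 \<or> (j mod 6) * 1 mod 6 = 3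
          \<or> (j mod 6) * 4 mod 6 = 2"
        by auto
      then show ?thesis unfolding mod_mult_left_eq by (metis mod_mod_trivial)
    qed
    then obtain k q where q: "q = 2 \<or> q = 3" "(j * k) mod 6 = q mod 6" by blast
    have eq: "pmap X ((F ^^ j) ^^ k) = pmap X (F ^^ q)"
      unfolding funpow_mult by (rule C.funpow_cong[OF q(2)])
    have "(pmap X ((F ^^ j) ^^ k), v) \<in> crel X"
      by (rule crel_total_funpow[OF crel_sym[OF uvw(3)[unfolded j]]])
        (use q(1) in \<open>auto simp: eq C.funpow_noncentral_iff\<close>)
    then have v2: "(pmap X (F ^^ q), v) \<in> crel X" unfolding eq .
    show False
    proof (rule common_centralizer_trivial[OF c, of UNIV
          "\<lambda>k. if k then six_collapse else (\<lambda>i. (i + q) mod 6)" "\<lambda>k. if k then L.collapse else F ^^ q" v])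
      show "v \<in> noncentral X" using v1 by (simp add: crel_def)
      show "(if k then six_collapse else (\<lambda>i. (i + q) mod 6)) i < 6" if "i < 6" for k i
        using that by (auto simp: six_collapse_def less_6_cases[of i])
      show "(if k then L.collapse else F ^^ q) (c i) = c ((if k then six_collapse else (\<lambda>i. (i + q) mod 6)) i)"
        if "i < 6" for k i
        using collapse[OF that] rot[OF that] by simp
      show "(pmap X (if k then L.collapse else F ^^ q), v) \<in> crel X" for k using v1 v2 by simp
    next
      fix P :: "nat \<Rightarrow> bool"
      assume P: "\<And>k i. k \<in> UNIV \<Longrightarrow> i < 6 \<Longrightarrow> P ((if k then six_collapse else (\<lambda>i. (i + q) mod 6)) i) \<longleftrightarrow> P i"
      have "P i \<longleftrightarrow> P 0" if "i < 6" for i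
        by (rule six_connected[OF _ _ q(1) that]) (use P[of True] P[of False] in simp_all)
      then show "\<forall>i<6. \<forall>j<6. P i \<longrightarrow> P j" by blast
    next
      fix g :: "nat \<Rightarrow> nat" and i :: nat
      assume g: "\<And>i. i < 6 \<Longrightarrow> g i < 6"
        "\<And>k i. k \<in> UNIV \<Longrightarrow> i < 6 \<Longrightarrow>
          g ((if k then six_collapse else (\<lambda>i. (i + q) mod 6)) i) = (if k then six_collapse else (\<lambda>i. (i + q) mod 6)) (g i)"
        "i < 6"
      show "g i = i"
        by (rule six_rigid[OF _ _ _ q(1) g(3)]) (use g(1) g(2)[of True] g(2)[of False] in simp_all)
    qed
  qed
  then show ?thesis using L.noncentral C.noncentral by blast
qed

section \<open>Four points\<close>

text \<open>The square of a 4-cycle is of this kind and replaces the cycle among the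
  partners.\<close>

definition fpf_inv :: "'a set \<Rightarrow> ('a \<Rightarrow> 'a) \<Rightarrow> bool" where
  "fpf_inv X A \<longleftrightarrow> (\<forall>x\<in>X. A x \<in> X \<and> A (A x) = x \<and> A x \<noteq> x)"

lemma fpf_inv_noncentral:
  assumes "fpf_inv X A" "x \<in> X"
  shows "pmap X A \<in> noncentral X"
proof -
  have "A ` X \<subseteq> X" "A x \<noteq> x" using assms by (auto simp: fpf_inv_def)
  then show ?thesis using assms(2) unfolding pmap_noncentral_iff by (metis empty_iff order_refl)
qed

lemma fpf_inv_orbit_iff:
  assumes "fpf_inv X A" "x \<in> X" "v \<in> X"
  shows "A v \<in> {x, A x} \<longleftrightarrow> v \<in> {x, A x}"
proof -
  have "A (A v) = v" "A (A x) = x" using assms by (auto simp: fpf_inv_def)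
  then have "A v = x \<longleftrightarrow> v = A x" "A v = A x \<longleftrightarrow> v = x" by metis+
  then show ?thesis unfolding insert_iff by blast
qed

lemma fpf_inv_orbits:
  assumes X: "finite X" "card X = 4" and A: "fpf_inv X A" and x: "x \<in> X"
  obtains y where "X = {x, A x, y, A y}" "distinct [x, A x, y, A y]"
proof -
  have Ax: "A x \<in> X" "A x \<noteq> x" "A (A x) = x" using A x by (auto simp: fpf_inv_def)
  obtain y where y: "y \<in> X" "y \<notin> {x, A x}" using ex_outside[of "{x, A x}" X] card_2_less[of x "A x" 0] X(2) by auto
  have Ay: "A y \<in> X" "A y \<noteq> y" "A (A y) = y" using A y by (auto simp: fpf_inv_def)
  then have "A y \<noteq> x" "A y \<noteq> A x" using Ax y by auto
  then have dist: "distinct [x, A x, y, A y]" using Ax y Ay by auto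
  then have "card {x, A x, y, A y} = 4" using distinct_card by fastforce
  then have "{x, A x, y, A y} = X" using X x Ax y Ay by (intro card_subset_eq) auto
  then show thesis using that dist by blast
qed

definition quad :: "'a \<Rightarrow> 'a \<Rightarrow> 'a \<Rightarrow> 'a \<Rightarrow> 'a \<Rightarrow> 'a \<Rightarrow> 'a \<Rightarrow> 'a \<Rightarrow> 'a \<Rightarrow> 'a" where
  "quad a b c d w x y z = (\<lambda>v. if v = a then w else if v = b then x else if v = c then y else z)"

lemma quad_simps:
  assumes "distinct [a, b, c, d]"
  shows "quad a b c d w x y z a = w" "quad a b c d w x y z b = x"
    "quad a b c d w x y z c = y" "quad a b c d w x y z d = z"
  using assms by (auto simp: quad_def)

lemma quad_crel:
  assumes X: "X = {a, b, c, d}" "distinct [a, b, c, d]" and Q: "w \<in> X" "x \<in> X" "y \<in> X" "z \<in> X"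
    and ne: "w \<noteq> a \<or> x \<noteq> b \<or> y \<noteq> c \<or> z \<noteq> d" and F: "pmap X F \<in> noncentral X"
    and comm: "quad a b c d w x y z (F a) = F w" "quad a b c d w x y z (F b) = F x"
      "quad a b c d w x y z (F c) = F y" "quad a b c d w x y z (F d) = F z"
  shows "(pmap X F, pmap X (quad a b c d w x y z)) \<in> crel X"
proof -
  let ?Q = "quad a b c d w x y z"
  note q = quad_simps[OF X(2), of w x y z]
  have "\<not> (\<forall>v\<in>X. ?Q v = v)" using ne X(1) q by auto
  moreover have "?Q ` X \<subseteq> X" "X \<noteq> {}" using Q X(1) q by auto
  ultimately have nc: "pmap X ?Q \<in> noncentral X" unfolding pmap_noncentral_iff by blast
  have FX: "F v \<in> X" if "v \<in> X" for v using F that by (auto simp: pmap_noncentral_iff)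
  have "\<forall>v\<in>X. ?Q (F v) = F (?Q v)" using comm q unfolding X(1) by simp
  then show ?thesis using nc FX by (subst crel_total_iff[OF F]) auto
qed

text \<open>A common fixed point gives a commuting constant. Otherwise the images are disjoint, so
  both have two points and together they exhaust \<open>X\<close>.\<close>

lemma idem_idem4:
  assumes X: "finite X" "card X = 4" and E: "idem2 X E" and E': "idem2 X E'"
  shows "(pmap X E, pmap X E') \<in> crel X ^^ 2"
proof (cases "\<exists>p\<in>X. E p = p \<and> E' p = p")
  case True
  then obtain p where p: "p \<in> X" "E p = p" "E' p = p" by blast
  have "(pmap X E, pmap X (\<lambda>_. p)) \<in> crel X" "(pmap X (\<lambda>_. p), pmap X E') \<in> crel X"
    by (intro crelI pmap_const_noncentral pmap_idem2_noncentral E E'; use p X E E' in \<open>simp add: idem2_def image_subset_iff\<close>)+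
  then show ?thesis by (rule relpow_2I)
next
  case False
  have im: "E x \<in> X" "E (E x) = E x" "E' x \<in> X" "E' (E' x) = E' x" if "x \<in> X" for x
    using that E E' by (auto simp: idem2_def)
  obtain a b where ab: "a \<in> X" "b \<in> X" "E a = a" "E b = b" "a \<noteq> b"
    using E im unfolding idem2_def by metis
  obtain c d where cd: "c \<in> X" "d \<in> X" "E' c = c" "E' d = d" "c \<noteq> d"
    using E' im unfolding idem2_def by metis
  have dist: "distinct [a, b, c, d]" using False ab cd by auto
  then have "card {a, b, c, d} = 4" using distinct_card by fastforce
  then have X4: "X = {a, b, c, d}" using X ab cd by (intro card_subset_eq[symmetric]) auto
  have Ev: "E x = a \<or> E x = b" if "x \<in> X" for x
    using im(1,2)[OF that] False cd unfolding X4 by auto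
  have Ev': "E' x = c \<or> E' x = d" if "x \<in> X" for x
    using im(3,4)[OF that] False ab unfolding X4 by auto
  note nc = pmap_idem2_noncentral[OF E] pmap_idem2_noncentral[OF E']
  note q = quad_simps[OF dist]
  show ?thesis
  proof (cases "\<exists>s\<in>{a, b}. \<exists>t\<in>{c, d}. E' s = t \<and> E t = s")
    case True
    \<comment> \<open>Given a pair exchanged by the two idempotents, collapsing each image onto its
      member of the pair commutes with both.\<close>
    then obtain s t where st: "s = a \<or> s = b" "t = c \<or> t = d" "E' s = t" "E t = s" by blast
    have st': "E s = s" "E' t = t" using st ab cd by auto
    have sX: "s \<in> X" "t \<in> X" using st ab cd by auto
    have ne: "s \<noteq> a \<or> s \<noteq> b \<or> t \<noteq> c \<or> t \<noteq> d" using ab by auto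
    have "quad a b c d s s t t (E x) = s" "quad a b c d s s t t (E' x) = t" if "x \<in> X" for x
      using Ev[OF that] Ev'[OF that] q by auto
    then have "(pmap X E, pmap X (quad a b c d s s t t)) \<in> crel X"
      "(pmap X E', pmap X (quad a b c d s s t t)) \<in> crel X"
      using st st' ab cd by (intro quad_crel[OF X4 dist sX(1) sX(1) sX(2) sX(2) ne] nc; simp add: q)+
    then show ?thesis using relpow_2I crel_sym by metis
  next
    case False
    \<comment> \<open>Without such a pair, alternating \<open>E'\<close> and \<open>E\<close> runs
      through all four points cyclically, and swapping the two points in each image commutes with
      both.\<close>
    have "(E' a = c \<and> E c = b \<and> E' b = d \<and> E d = a) \<or> (E' a = d \<and> E d = b \<and> E' b = c \<and> E c = a)"
      using False Ev[OF cd(1)] Ev[OF cd(2)] Ev'[OF ab(1)] Ev'[OF ab(2)] by auto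
    then have "(pmap X E, pmap X (quad a b c d b a d c)) \<in> crel X"
      "(pmap X E', pmap X (quad a b c d b a d c)) \<in> crel X"
      using ab cd by (elim disjE conjE; (intro quad_crel[OF X4 dist] nc; simp add: q))+
    then show ?thesis using relpow_2I crel_sym by metis
  qed
qed

lemma idem_fpf4:
  assumes X: "finite X" "card X = 4" and E: "idem2 X E" and A: "fpf_inv X A"
  shows "(pmap X E, pmap X A) \<in> crel X ^^ 2"
proof -
  have im: "E x \<in> X" "E (E x) = E x" if "x \<in> X" for x
    using that E by (auto simp: idem2_def)
  have inv: "A x \<in> X" "A (A x) = x" "A x \<noteq> x" if "x \<in> X" for x
    using that A by (auto simp: fpf_inv_def)
  have ncE: "pmap X E \<in> noncentral X" by (rule pmap_idem2_noncentral[OF E])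
  have ncA: "pmap X A \<in> noncentral X" using fpf_inv_noncentral[OF A] X(2) by fastforce
  have via: "(pmap X E, pmap X A) \<in> crel X ^^ 2"
    if "X = {a, b, c, d}" "distinct [a, b, c, d]" "A a = b" "A b = a" "A c = d" "A d = c"
      "w \<in> X" "x \<in> X" "y \<in> X" "z \<in> X" "w \<noteq> a \<or> x \<noteq> b \<or> y \<noteq> c \<or> z \<noteq> d"
      "quad a b c d w x y z (E a) = E w" "quad a b c d w x y z (E b) = E x"
      "quad a b c d w x y z (E c) = E y" "quad a b c d w x y z (E d) = E z"
      "A w = x" "A y = z" for a b c d w x y z
  proof -
    note q = quad_simps[OF that(2)]
    have "A x = w" "A z = y" using inv(2)[OF that(7)] inv(2)[OF that(9)] that(16,17) by simp_all
    then have "(pmap X A, pmap X (quad a b c d w x y z)) \<in> crel X"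
      using that(3-11,16,17) q by (intro quad_crel[OF that(1,2)] ncA; simp)
    moreover have "(pmap X E, pmap X (quad a b c d w x y z)) \<in> crel X"
      using that(7-15) by (intro quad_crel[OF that(1,2)] ncE)
    ultimately show ?thesis using relpow_2I crel_sym by metis
  qed
  show ?thesis
  proof (cases "\<exists>p\<in>X. E p = p \<and> E (A p) = p")
    case True
    then obtain p where p: "p \<in> X" "E p = p" "E (A p) = p" by blast
    obtain y0 where y0: "X = {p, A p, y0, A y0}" "distinct [p, A p, y0, A y0]"
      using fpf_inv_orbits[OF X A p(1)] .
    show ?thesis
    proof (cases "E y0 = y0 \<and> E (A y0) = A y0")
      case True
      have nc: "pmap {p, A p} (\<lambda>x. x) \<in> noncentral X" using y0 by (intro pmap_id_noncentral) auto
      have "E v \<in> {p, A p} \<longleftrightarrow> v \<in> {p, A p}" if "v \<in> X" for v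
      proof -
        have "v = p \<or> v = A p \<or> v = y0 \<or> v = A y0" using that y0(1) by blast
        then show ?thesis using True p(2,3) by (elim disjE) simp_all
      qed
      then have "(pmap X E, pmap {p, A p} (\<lambda>x. x)) \<in> crel X" "(pmap X A, pmap {p, A p} (\<lambda>x. x)) \<in> crel X"
        unfolding crel_total_iff[OF ncE] crel_total_iff[OF ncA]
        using nc fpf_inv_orbit_iff[OF A p(1)] by blast+
      then show ?thesis using relpow_2I crel_sym by metis
    next
      case False
      \<comment> \<open>Choosing \<open>y\<close> in the second orbit with \<open>A y\<close> not
        fixed confines the image of \<open>E\<close> to \<open>{p, y}\<close>. Folding the second
        orbit onto the first, \<open>y\<close> to \<open>p\<close>, then commutes with
        \<open>E\<close> and \<open>A\<close>.\<close>
      obtain y where y: "X = {p, A p, y, A y}" "distinct [p, A p, y, A y]" "E (A y) \<noteq> A y"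
      proof (cases "E (A y0) = A y0")
        case True
        have "A (A y0) = y0" using inv(2)[of y0] y0(1) by blast
        then show thesis using that[of "A y0"] y0 False True by (auto simp: insert_commute)
      qed (use that y0 in blast)
      have Ay: "A y \<in> X" "y \<in> X" "A p \<in> X" using y(1) by blast+
      have nA: "E v \<noteq> A y" "E v \<noteq> A p" if "v \<in> X" for v
        using im[OF that] y(2,3) p(3) by auto
      have Ev: "E v = p \<or> E v = y" if "v \<in> X" for v
        using im(1)[OF that] nA[OF that] y(1) by blast
      note q = quad_simps[OF y(2)]
      have "quad p (A p) y (A y) p (A p) p (A p) (E v) = p" if "v \<in> X" for v
        using Ev[OF that] q by auto
      then show ?thesis
        using p Ay inv[OF p(1)] inv[OF Ay(2)] y(2)
        by (intro via[OF y(1,2), of p "A p" p "A p"]) (simp_all add: q)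
    qed
  next
    case no: False
    obtain u where u: "u \<in> X" "E u \<noteq> u" using E by (auto simp: idem2_def)
    define p where "p = A u"
    have p: "p \<in> X" "A p = u" using inv[OF u(1)] by (auto simp: p_def)
    show ?thesis
    proof (cases "E p = p")
      case True
      define v where "v = E u"
      have v: "v \<in> X" "E v = v" "v \<noteq> u" using im[OF u(1)] u by (auto simp: v_def)
      have vp: "v \<noteq> p" using no p True v_def by auto
      obtain y where y: "X = {p, u, y, A y}" "distinct [p, u, y, A y]"
        using fpf_inv_orbits[OF X A p(1)] p(2) by metis
      have "v = y \<or> v = A y" using v vp y(1) by auto
      then have X4: "X = {u, p, v, A v}" "distinct [u, p, v, A v]"
        using y inv(2)[of y] by auto
      have Av: "A v \<in> X" "A (A v) = v" "A u = p" using inv[OF v(1)] by (auto simp: p_def)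
      note q = quad_simps[OF X4(2)]
      show ?thesis
      \<comment> \<open>If \<open>A v\<close> is fixed, the orbit of \<open>u\<close> is folded onto
        that of \<open>v\<close>; otherwise \<open>E (A v) = p\<close>, and the partner exchanges
        \<open>u\<close> with \<open>A v\<close> and \<open>p\<close> with \<open>v\<close>.\<close>
      proof (cases "E (A v) = A v")
        case True2: True
        show ?thesis
          using p v Av True True2 u(1) X4(2) v_def[symmetric]
          by (intro via[OF X4, of v "A v" v "A v"]) (simp_all add: q)
      next
        case False
        have "E (A v) \<in> X" "E (E (A v)) = E (A v)" "E (A v) \<noteq> v"
          using im[OF Av(1)] no v by auto
        then have "E (A v) = p" using X4(1) u(2) False by auto
        then show ?thesis
          using p v Av True u(1) X4(2) v_def[symmetric]
          by (intro via[OF X4, of "A v" v p u]) (simp_all add: q)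
      qed
    next
      case False
      obtain y where y: "X = {u, p, y, A y}" "distinct [u, p, y, A y]"
        using fpf_inv_orbits[OF X A u(1)] p_def by metis
      have Ay: "A y \<in> X" "y \<in> X" "A (A y) = y" "A u = p" using y(1) inv[of y] by (auto simp: p_def)
      have Ev: "E v = y \<or> E v = A y" if "v \<in> X" for v
        using im[OF that] u False y(1) by auto
      obtain s t where "s \<in> X" "t \<in> X" "E s \<noteq> E t" using E by (auto simp: idem2_def)
      then have fixed: "E y = y" "E (A y) = A y" using Ev im by metis+
      note q = quad_simps[OF y(2)]
      show ?thesis
      \<comment> \<open>The image of \<open>E\<close> is the orbit of \<open>y\<close>. If
        \<open>u\<close> and \<open>p\<close> have the same image, swapping them is enough;
        otherwise \<open>E\<close> itself commutes with \<open>A\<close> and serves as its own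
        partner.\<close>
      proof (cases "E u = E p")
        case True
        have "quad u p y (A y) p u y (A y) (E p) = E p" using Ev[OF p(1)] q by (elim disjE) simp_all
        then show ?thesis
          using p u Ay fixed True y(2)
          by (intro via[OF y, of p u y "A y"]) (simp_all add: q)
      next
        case False
        have "A (E u) = E p" using False Ev[OF u(1)] Ev[OF p(1)] Ay by auto
        moreover have "quad u p y (A y) (E u) (E p) y (A y) (E u) = E u"
          "quad u p y (A y) (E u) (E p) y (A y) (E p) = E p"
          using Ev[OF p(1)] Ev[OF u(1)] q by (elim disjE; simp)+
        ultimately show ?thesis
          using p u Ay fixed y(2) im[OF u(1)] im[OF p(1)]
          by (intro via[OF y, of "E u" "E p" y "A y"]) (simp_all add: q)
      qed
    qed
  qed
qed

lemma fpf_sub_ex: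
  assumes X: "finite X" "card X = 4" and A: "fpf_inv X A"
  obtains B where "B \<noteq> {}" "B \<subset> X" "(pmap X A, pmap B (\<lambda>x. x)) \<in> crel X"
proof -
  obtain x where x: "x \<in> X" using X(2) by fastforce
  obtain y where y: "X = {x, A x, y, A y}" "distinct [x, A x, y, A y]"
    using fpf_inv_orbits[OF X A x] .
  have inv: "A v \<in> X" "A (A v) = v" if "v \<in> X" for v using that A by (auto simp: fpf_inv_def)
  show thesis
  proof (rule that[of "{x, A x}"])
    show B: "{x, A x} \<noteq> {}" "{x, A x} \<subset> X" using y by auto
    have "A v \<in> {x, A x} \<longleftrightarrow> v \<in> {x, A x}" if "v \<in> X" for v
      by (rule fpf_inv_orbit_iff[OF A x that])
    then show "(pmap X A, pmap {x, A x} (\<lambda>x. x)) \<in> crel X"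
      using pmap_id_noncentral[OF B] by (subst crel_total_iff[OF fpf_inv_noncentral[OF A x]]) auto
  qed
qed

lemma point_fpf4:
  assumes X: "finite X" "card X = 4" and x: "x \<in> X" "r \<in> X" and A: "fpf_inv X A"
  shows "(pmap {x} (\<lambda>_. r), pmap X A) \<in> crel X ^^ 2"
proof -
  have inv: "A v \<in> X" "A (A v) = v" "A v \<noteq> v" if "v \<in> X" for v using that A by (auto simp: fpf_inv_def)
  have ncA: "pmap X A \<in> noncentral X" by (rule fpf_inv_noncentral[OF A x(1)])
  have ncp: "pmap {x} (\<lambda>_. r) \<in> noncentral X" using X by (intro pmap_point_noncentral x) simp
  obtain y where y: "X = {x, A x, y, A y}" "distinct [x, A x, y, A y]"
    using fpf_inv_orbits[OF X A x(1)] .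
  have yX: "y \<in> X" using y(1) by blast
  show ?thesis
  proof (cases "r = x \<or> r = A x")
    case True
    let ?B = "{y, A y}"
    have nc: "pmap ?B (\<lambda>x. x) \<in> noncentral X" using y by (intro pmap_id_noncentral) auto
    have "(pmap {x} (\<lambda>_. r), pmap ?B (\<lambda>x. x)) \<in> crel X"
      using True y(2) by (intro crelI ncp nc) auto
    moreover have "A v \<in> ?B \<longleftrightarrow> v \<in> ?B" if "v \<in> X" for v
      by (rule fpf_inv_orbit_iff[OF A yX that])
    then have "(pmap X A, pmap ?B (\<lambda>x. x)) \<in> crel X"
      using nc by (subst crel_total_iff[OF ncA]) auto
    ultimately show ?thesis using relpow_2I crel_sym by metis
  next
    case False
    \<comment> \<open>When \<open>r\<close> is outside the orbit of \<open>x\<close>, the one-point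
      map is extended to that orbit so as to commute with \<open>A\<close>; its products with the
      one-point map are empty.\<close>
    let ?B = "{x, A x}" and ?G = "\<lambda>v. if v = x then r else A r"
    have Ar: "A r \<in> X" "A r \<noteq> x" "A (A r) = r" using inv[OF x(2)] inv[OF x(1)] False by auto
    have nc: "pmap ?B ?G \<in> noncentral X" using y x Ar by (auto simp: pmap_noncentral_iff)
    have "(pmap {x} (\<lambda>_. r), pmap ?B ?G) \<in> crel X"
      using False Ar by (intro crelI ncp nc) (auto split: if_splits)
    moreover have "A v \<in> ?B \<longleftrightarrow> v \<in> ?B" if "v \<in> X" for v
      by (rule fpf_inv_orbit_iff[OF A x(1) that])
    then have "(pmap X A, pmap ?B ?G) \<in> crel X"
      using nc Ar inv[OF x(1)] by (subst crel_total_iff[OF ncA]) auto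
    ultimately show ?thesis using relpow_2I crel_sym by metis
  qed
qed

text \<open>The middle map is the identity on the orbit of \<open>a\<close> and agrees with
  \<open>A\<close> elsewhere.\<close>

lemma const_fpf:
  assumes X: "card X \<ge> 3" and A: "fpf_inv X A" and a: "a \<in> X"
  shows "(pmap X (\<lambda>_. a), pmap X A) \<in> crel X ^^ 2"
proof -
  have inv: "A v \<in> X" "A (A v) = v" "A v \<noteq> v" if "v \<in> X" for v using that A by (auto simp: fpf_inv_def)
  define G where "G v = (if v = a \<or> v = A a then v else A v)" for v
  obtain z where z: "z \<in> X" "z \<notin> {a, A a}"
    using ex_outside[of "{a, A a}" X] card_2_less[of a "A a" 0] X by auto
  then have "G z \<noteq> z" using inv by (auto simp: G_def)
  moreover have "G ` X \<subseteq> X" using inv by (auto simp: G_def)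
  ultimately have nc: "pmap X G \<in> noncentral X"
    using z(1) unfolding pmap_noncentral_iff by (metis empty_iff order_refl)
  have "(pmap X (\<lambda>_. a), pmap X G) \<in> crel X"
    using X a inv(1) by (intro crelI nc pmap_const_noncentral) (auto simp: G_def)
  moreover have "G (A v) = A (G v)" if "v \<in> X" for v
    using inv(2)[OF that] inv(2)[OF a] by (auto simp: G_def)
  then have "(pmap X G, pmap X A) \<in> crel X"
    using inv(1) by (intro crelI nc fpf_inv_noncentral[OF A a]) (auto simp: G_def)
  ultimately show ?thesis by (rule relpow_2I)
qed

text \<open>On four points the fixed-point-free involutions together with the identity form the
  Klein four-group.\<close>

lemma fpf_fpf4:
  assumes X: "finite X" "card X = 4" and A: "fpf_inv X A" and B: "fpf_inv X B"
  shows "(pmap X A, pmap X B) \<in> crel X"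
proof -
  have invA: "A v \<in> X" "A (A v) = v" "A v \<noteq> v" if "v \<in> X" for v using that A by (auto simp: fpf_inv_def)
  have invB: "B v \<in> X" "B (B v) = v" "B v \<noteq> v" if "v \<in> X" for v using that B by (auto simp: fpf_inv_def)
  have comm: "B (A x) = A (B x)" if x: "x \<in> X" for x
  proof -
    obtain y where y: "X = {x, A x, y, A y}" "distinct [x, A x, y, A y]"
      using fpf_inv_orbits[OF X A x] .
    have AxX: "A x \<in> X" and yX: "y \<in> X" using y(1) by blast+
    show ?thesis
    proof (cases "B x = A x")
      case True
      then show ?thesis using invA(2)[OF x] invB(2)[OF x] by simp
    next
      case False
      then have Bx: "B x = y \<or> B x = A y" using invB(1,3)[OF x] y(1) by auto
      have "B (A x) \<noteq> x" "B (A x) \<noteq> A x" "B (A x) \<noteq> B x"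
        using False invB(2)[OF AxX] invB(2)[OF x] invB(3)[OF AxX] invA(3)[OF x] by metis+
      then have "B (A x) = y \<and> B x = A y \<or> B (A x) = A y \<and> B x = y"
        using Bx invB(1)[OF AxX] y(1) by auto
      then show ?thesis using invA(2)[OF yX] by auto
    qed
  qed
  obtain x where "x \<in> X" using X(2) by fastforce
  then show ?thesis
    using comm invA invB by (intro crelI fpf_inv_noncentral[OF A] fpf_inv_noncentral[OF B]) auto
qed

lemma cyc_fpf4:
  assumes X: "finite X" "card X = 4" and F: "cyc_perm X F"
  obtains A where "fpf_inv X A" "(pmap X F, pmap X A) \<in> crel X"
proof (rule that[of "F ^^ 2"])
  show "fpf_inv X (F ^^ 2)"
    unfolding fpf_inv_def
  proof (intro ballI conjI)
    fix x assume x: "x \<in> X"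
    show "(F ^^ 2) x \<in> X" by (rule funpow_closed[OF cyc_permD(1)[OF F] x])
    show "(F ^^ 2) ((F ^^ 2) x) = x"
      using cyc_perm_orbit(3)[OF X(1) F x] unfolding funpow_funpow X(2) by simp
    show "(F ^^ 2) x \<noteq> x"
      using inj_onD[OF cyc_perm_orbit(2)[OF X(1) F x], of 2 0] X(2) by auto
  qed
  show "(pmap X F, pmap X (F ^^ 2)) \<in> crel X"
    using X by (intro cyc_perm_power F) auto
qed

text \<open>The partners of \<open>noncentral_obtain\<close>, with a full cycle replaced by its
  square, collected in one predicate so that pairs can be treated by case analysis.\<close>

inductive standard_map :: "'a set \<Rightarrow> ('a \<rightharpoonup> 'a) \<Rightarrow> bool" for X where
  point: "x \<in> X \<Longrightarrow> r \<in> X \<Longrightarrow> standard_map X (pmap {x} (\<lambda>_. r))"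
| idem: "idem2 X E \<Longrightarrow> standard_map X (pmap X E)"
| const: "a \<in> X \<Longrightarrow> standard_map X (pmap X (\<lambda>_. a))"
| sub: "A \<noteq> {} \<Longrightarrow> A \<subset> X \<Longrightarrow> standard_map X (pmap A (\<lambda>x. x))"
| fpf: "fpf_inv X A \<Longrightarrow> standard_map X (pmap X A)"

lemma standard_map_near:
  assumes X: "finite X" "card X = 4" and f: "f \<in> noncentral X"
  obtains t where "standard_map X t" "(f, t) \<in> crel X"
proof -
  have X2: "card X \<ge> 2" using X(2) by simp
  show thesis
    using X(1) X2 f
  proof (cases rule: noncentral_obtain)
    case (point x r)
    show ?thesis by (rule that[OF standard_map.point[OF point(1,2)] point(3)])
  next
    case (idem E)
    show ?thesis by (rule that[OF standard_map.idem[OF idem(1)] idem(2)])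
  next
    case (const a)
    show ?thesis by (rule that[OF standard_map.const[OF const(1)] const(2)])
  next
    case (sub A)
    show ?thesis by (rule that[OF standard_map.sub[OF sub(1,2)] sub(3)])
  next
    case (cyc F)
    obtain A where A: "fpf_inv X A" "(pmap X F, pmap X A) \<in> crel X" using cyc_fpf4[OF X cyc(2)] .
    show ?thesis by (rule that[OF standard_map.fpf[OF A(1)] A(2)[folded cyc(1)]])
  qed
qed

text \<open>There are fifteen unordered pairs of kinds. Subset identities, one-point maps,
  constants, idempotents and involutions are settled in this order, each reusing the earlier ones by
  symmetry.\<close>

lemma standard_maps_crel2:
  assumes X: "finite X" "card X = 4" and s: "standard_map X s" and t: "standard_map X t"
  shows "(s, t) \<in> crel X ^^ 2"
proof -
  have X': "card X \<ge> 2" "card X \<ge> 3" "card X \<ge> 4" using X(2) by auto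
  have sub: "(t, pmap A (\<lambda>x. x)) \<in> crel X ^^ 2" if t: "standard_map X t" and A: "A \<noteq> {}" "A \<subset> X" for t A
    using t
  proof cases
    case (point x r)
    obtain B where B: "B \<noteq> {}" "B \<subset> X" "(t, pmap B (\<lambda>x. x)) \<in> crel X"
      using point_sub_ex[OF X(1) X'(2) point(2,3)] point(1) by metis
    show ?thesis by (rule relpow_2I[OF B(3) sub_sub[OF B(1,2) A]])
  next
    case (idem E)
    obtain B where B: "B \<noteq> {}" "B \<subset> X" "(t, pmap B (\<lambda>x. x)) \<in> crel X"
      using idem_sub_ex[OF idem(2)] idem(1) by metis
    show ?thesis by (rule relpow_2I[OF B(3) sub_sub[OF B(1,2) A]])
  next
    case (const a)
    then show ?thesis using const_sub[OF X'(2) const(2) A] by simp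
  next
    case (sub B)
    show ?thesis unfolding sub(1)
      by (rule relpow_2I[OF sub_sub[OF sub(2,3) sub(2,3)] sub_sub[OF sub(2,3) A]])
  next
    case (fpf F)
    obtain B where B: "B \<noteq> {}" "B \<subset> X" "(t, pmap B (\<lambda>x. x)) \<in> crel X"
      using fpf_sub_ex[OF X fpf(2)] fpf(1) by metis
    show ?thesis by (rule relpow_2I[OF B(3) sub_sub[OF B(1,2) A]])
  qed
  have pt: "(pmap {x} (\<lambda>_. r), t) \<in> crel X ^^ 2" if x: "x \<in> X" "r \<in> X" and t: "standard_map X t" for x r t
    using t
  proof cases
    case (point y q)
    show ?thesis unfolding point(1) by (rule point_point[OF X'(2) x point(2,3)])
  next
    case (idem E)
    show ?thesis unfolding idem(1) by (rule point_idem[OF X'(1) x idem(2)])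
  next
    case (const a)
    show ?thesis unfolding const(1) by (rule point_const[OF X(1) X'(3) x const(2)])
  next
    case A: (sub A)
    show ?thesis unfolding A(1) by (rule sub[OF standard_map.point[OF x] A(2,3)])
  next
    case (fpf F)
    show ?thesis unfolding fpf(1) by (rule point_fpf4[OF X x fpf(2)])
  qed
  have cn: "(pmap X (\<lambda>_. a), t) \<in> crel X ^^ 2" if a: "a \<in> X" and t: "standard_map X t" for a t
    using t
  proof cases
    case (point y q)
    show ?thesis unfolding point(1)
      by (rule crel_pow_sym[OF pt[OF point(2,3) standard_map.const[OF a]]])
  next
    case (idem E)
    show ?thesis unfolding idem(1) by (rule crel_pow_sym[OF idem_const[OF X'(2) idem(2) a]])
  next
    case (const b)
    show ?thesis unfolding const(1) by (rule const_const[OF X'(2) a const(2)])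
  next
    case A: (sub A)
    show ?thesis unfolding A(1) by (rule sub[OF standard_map.const[OF a] A(2,3)])
  next
    case (fpf F)
    show ?thesis unfolding fpf(1) by (rule const_fpf[OF X'(2) fpf(2) a])
  qed
  have id: "(pmap X E, t) \<in> crel X ^^ 2" if E: "idem2 X E" and t: "standard_map X t" for E t
    using t
  proof cases
    case (point y q)
    show ?thesis unfolding point(1)
      by (rule crel_pow_sym[OF pt[OF point(2,3) standard_map.idem[OF E]]])
  next
    case (idem E')
    show ?thesis unfolding idem(1) by (rule idem_idem4[OF X E idem(2)])
  next
    case (const b)
    show ?thesis unfolding const(1)
      by (rule crel_pow_sym[OF cn[OF const(2) standard_map.idem[OF E]]])
  next
    case A: (sub A)
    show ?thesis unfolding A(1) by (rule sub[OF standard_map.idem[OF E] A(2,3)])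
  next
    case (fpf F)
    show ?thesis unfolding fpf(1) by (rule idem_fpf4[OF X E fpf(2)])
  qed
  have fp: "(pmap X F, t) \<in> crel X ^^ 2" if F: "fpf_inv X F" and t: "standard_map X t" for F t
    using t
  proof cases
    case (point y q)
    show ?thesis unfolding point(1)
      by (rule crel_pow_sym[OF pt[OF point(2,3) standard_map.fpf[OF F]]])
  next
    case (idem E)
    show ?thesis unfolding idem(1)
      by (rule crel_pow_sym[OF id[OF idem(2) standard_map.fpf[OF F]]])
  next
    case (const b)
    show ?thesis unfolding const(1)
      by (rule crel_pow_sym[OF cn[OF const(2) standard_map.fpf[OF F]]])
  next
    case A: (sub A)
    show ?thesis unfolding A(1) by (rule sub[OF standard_map.fpf[OF F] A(2,3)])
  next
    case (fpf G)
    show ?thesis unfolding fpf(1)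
      by (rule relpow_2I[OF fpf_fpf4[OF X F F] fpf_fpf4[OF X F fpf(2)]])
  qed
  show ?thesis
    using s
  proof cases
    case A: (sub A)
    show ?thesis unfolding A(1) by (rule crel_pow_sym[OF sub[OF t A(2,3)]])
  qed (use pt cn id fp t in simp_all)
qed

lemma crel4_card4:
  assumes X: "finite X" "card X = 4" and f: "f \<in> noncentral X" and g: "g \<in> noncentral X"
  shows "(f, g) \<in> crel X ^^ 4"
proof -
  obtain s where s: "standard_map X s" "(f, s) \<in> crel X" using standard_map_near[OF X f] .
  obtain t where t: "standard_map X t" "(g, t) \<in> crel X" using standard_map_near[OF X g] .
  have "(f, s) \<in> crel X ^^ 1" "(s, t) \<in> crel X ^^ 2" "(t, g) \<in> crel X ^^ 1"
    using standard_maps_crel2[OF X s(1) t(1)] s(2) crel_sym[OF t(2)] by simp_all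
  then have "(f, g) \<in> crel X ^^ (1 + 2 + 1)" by (intro relpow_trans)
  then show ?thesis by (simp add: numeral_eq_Suc)
qed

theorem theorem3p15:
  fixes X :: "'a set"
  assumes "finite X" and "card X \<ge> 2"
  shows "(prime (card X) \<longrightarrow>
            \<not> Digraph_Component.connected (with_proj (commuting_graph (partial_transformations X))))
       \<and> (card X = 4 \<longrightarrow>
            diam (with_proj (commuting_graph (partial_transformations X))) = 4)
       \<and> (card X \<ge> 6 \<and> \<not> prime (card X) \<longrightarrow>
            diam (with_proj (commuting_graph (partial_transformations X))) = 5)"
proof -
  have Suc: "Suc 3 = 4" "Suc 4 = 5" by simp_all
  show ?thesis
  proof (intro conjI impI)
    show "\<not> Digraph_Component.connected (cgraph X)" if "prime (card X)"
      using prime_not_connected assms that by blast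
  next
    assume 4: "card X = 4"
    obtain f g where fg: "f \<in> noncentral X" "g \<in> noncentral X" "(f, g) \<notin> crel X ^^ 3"
      using lower4[OF assms] by blast
    have "diam (cgraph X) = enat (Suc 3)"
      using crel4_card4[OF assms(1) 4] by (intro diam_cgraph_eqI[OF _ fg]) (simp only: Suc)
    then show "diam (cgraph X) = 4" by (simp add: numeral_eq_enat)
  next
    assume c: "card X \<ge> 6 \<and> \<not> prime (card X)"
    then have c3: "card X \<ge> 3" "\<not> prime (card X)" by simp_all
    \<comment> \<open>The explicit pairs cover six points and at least eight; seven is
      prime.\<close>
    from c have "card X \<noteq> 7" by auto
    then have "card X = 6 \<or> card X \<ge> 8" using c by linarith
    then obtain f g where fg: "f \<in> noncentral X" "g \<in> noncentral X" "(f, g) \<notin> crel X ^^ 4"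
      using lower5_6[OF assms(1)] lower5_ge8[OF assms(1)] by metis
    have "diam (cgraph X) = enat (Suc 4)"
      using composite_crel5[OF assms(1) c3] by (intro diam_cgraph_eqI[OF _ fg]) (simp only: Suc)
    then show "diam (cgraph X) = 5" by (simp add: numeral_eq_enat)
  qed
qed

end
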